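(* Let $k\ge1$ be an integer, let $M$ and $X$ be compact Riemannian manifolds of class $C^k$, and let $\{\mu_x\}_{x\in X}$ be a family of Borel probability measures on $M$. If the family $\{\mu_x\}_{x\in X}$ is boundedly $C^k$-representable, then for every function $h\in C^k(M)$, the function $E_h:X\to\mathbb{R}$ defined by $$E_h(x):=\int_M h\,\mathrm{d}\mu_x$$ is of class $C^k(X)$.
   Context: Boundedly $C^k$-representable: there exist a Rochlin–Lebesgue probability space $(\Omega,\mathbb{P})$, a measurable map $T:X\times\Omega\to M$ and a constant $C>0$ such that $T(x,\cdot)_*\mathbb{P}=\mu_x$ (push-forward) for every $x\in X$, and for every $\omega\in\Omega$ the map $x\mapsto T(x,\omega)$ is of class $C^k$ with $C^k$-seminorm bounded by $C$. Here $C^k$-seminorms are computed in the charts of a fixed finite atlas of $X$ and after a fixed embedding of $M$ into a Euclidean space (different choices give equivalent notions of uniform boundedness). *)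

theory Defs
  imports "HOL-Probability.Probability"
begin

text \<open>
  The model space of an \<open>n\<close>-dimensional manifold is an \<open>n\<close>-dimensional linear subspace \<open>V\<close> of a
  Euclidean space \<open>'e\<close>, rather than \<open>'e\<close> itself, so that dimension \<open>0\<close> is not
  excluded (the class \<open>euclidean_space\<close> forces \<open>DIM('e) \<ge> 1\<close>). Only directions in \<open>V\<close> are used,
  so everything below is intrinsic to \<open>V\<close>; in all uses \<open>U\<close> is relatively open in \<open>V\<close>.
\<close>

definition dir_deriv :: "'e \<Rightarrow> ('e::real_normed_vector \<Rightarrow> 'f::real_normed_vector) \<Rightarrow> 'e \<Rightarrow> 'f" where
  "dir_deriv v f x = vector_derivative (\<lambda>t. f (x + t *\<^sub>R v)) (at 0)"

primrec ck_on :: "'e::real_normed_vector set \<Rightarrow> nat \<Rightarrow> 'e set \<Rightarrow> ('e \<Rightarrow> 'f::real_normed_vector) \<Rightarrow> bool" where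
  "ck_on V 0 U f \<longleftrightarrow> continuous_on U f"
| "ck_on V (Suc k) U f \<longleftrightarrow> continuous_on U f \<and>
     (\<forall>v\<in>V. (\<forall>x\<in>U. (\<lambda>t. f (x + t *\<^sub>R v)) differentiable (at 0)) \<and> ck_on V k U (dir_deriv v f))"

text \<open>
  For \<open>f\<close> of class \<open>C\<^sup>j\<close>, where \<open>j = length vs\<close>, \<open>iter_dir_deriv vs f x\<close> is the \<open>j\<close>-th derivative
  \<open>D\<^sup>j f(x)\<close> evaluated at the vectors \<open>vs\<close>.
\<close>

primrec iter_dir_deriv :: "'e list \<Rightarrow> ('e::real_normed_vector \<Rightarrow> 'f::real_normed_vector) \<Rightarrow> 'e \<Rightarrow> 'f" where
  "iter_dir_deriv [] f = f"
| "iter_dir_deriv (v # vs) f = iter_dir_deriv vs (dir_deriv v f)"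

text \<open>
  A manifold is a whole type \<open>'m\<close>, assumed Hausdorff and second countable, with a maximal atlas.
  A chart is a domain together with a map; the values of the map off the domain are irrelevant.
\<close>

type_synonym ('m, 'e) chart = "'m set \<times> ('m \<Rightarrow> 'e)"

definition chart_image :: "('m, 'e) chart \<Rightarrow> 'e set" where
  "chart_image c = snd c ` fst c"

definition local_rep :: "('m, 'e) chart \<Rightarrow> ('m \<Rightarrow> 'a) \<Rightarrow> 'e \<Rightarrow> 'a" where
  "local_rep c f = f \<circ> inv_into (fst c) (snd c)"

definition is_chart :: "'e::euclidean_space set \<Rightarrow> ('m::topological_space, 'e) chart \<Rightarrow> bool" where
  "is_chart V c \<longleftrightarrow> open (fst c) \<and> openin (top_of_set V) (chart_image c) \<and>
     homeomorphic_map (top_of_set (fst c)) (top_of_set (chart_image c)) (snd c)"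

definition compatible_charts ::
    "nat \<Rightarrow> 'e::euclidean_space set \<Rightarrow> ('m::topological_space, 'e) chart \<Rightarrow> ('m, 'e) chart \<Rightarrow> bool" where
  "compatible_charts k V c d \<longleftrightarrow>
     ck_on V k (snd c ` (fst c \<inter> fst d)) (local_rep c (snd d)) \<and>
     ck_on V k (snd d ` (fst c \<inter> fst d)) (local_rep d (snd c))"

definition ck_structure ::
    "nat \<Rightarrow> 'e::euclidean_space set \<Rightarrow> ('m::{t2_space, second_countable_topology}, 'e) chart set \<Rightarrow> bool" where
  "ck_structure k V A \<longleftrightarrow> subspace V \<and>
     (\<forall>c\<in>A. is_chart V c) \<and> (\<Union>c\<in>A. fst c) = UNIV \<and>
     (\<forall>c\<in>A. \<forall>d\<in>A. compatible_charts k V c d) \<and>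
     (\<forall>c. is_chart V c \<and> (\<forall>d\<in>A. compatible_charts k V c d) \<longrightarrow> c \<in> A)"

definition finite_subatlas :: "('m, 'e) chart set \<Rightarrow> ('m, 'e) chart set \<Rightarrow> bool" where
  "finite_subatlas A B \<longleftrightarrow> B \<subseteq> A \<and> finite B \<and> (\<Union>c\<in>B. fst c) = UNIV"

text \<open>
  A Riemannian metric is given by its coordinate expressions: \<open>g c p u v\<close> is the inner product, at
  the point \<open>p\<close> of the domain of the chart \<open>c\<close>, of the tangent vectors with coordinates \<open>u\<close> and \<open>v\<close>
  in \<open>c\<close>. The tangent bundle of a \<open>C\<^sup>k\<close> manifold is only of class \<open>C\<^sup>k\<^sup>-\<^sup>1\<close>, hence so is the metric.
\<close>

definition riemannian_metric ::
    "nat \<Rightarrow> 'e::euclidean_space set \<Rightarrow> ('m, 'e) chart set \<Rightarrow>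
     (('m, 'e) chart \<Rightarrow> 'm \<Rightarrow> 'e \<Rightarrow> 'e \<Rightarrow> real) \<Rightarrow> bool" where
  "riemannian_metric k V A g \<longleftrightarrow>
     (\<forall>c\<in>A. \<forall>p\<in>fst c.
        (\<forall>u\<in>V. \<forall>v\<in>V. g c p u v = g c p v u) \<and>
        (\<forall>u\<in>V. \<forall>v\<in>V. \<forall>w\<in>V. \<forall>a b. g c p (a *\<^sub>R u + b *\<^sub>R v) w = a * g c p u w + b * g c p v w) \<and>
        (\<forall>u\<in>V. u \<noteq> 0 \<longrightarrow> g c p u u > 0)) \<and>
     (\<forall>c\<in>A. \<forall>u\<in>V. \<forall>v\<in>V. ck_on V (k - 1) (chart_image c) (local_rep c (\<lambda>p. g c p u v))) \<and>
     (\<forall>c\<in>A. \<forall>d\<in>A. \<forall>p\<in>fst c \<inter> fst d. \<forall>u\<in>V. \<forall>v\<in>V.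
        g c p u v = g d p (dir_deriv u (local_rep c (snd d)) (snd c p))
                          (dir_deriv v (local_rep c (snd d)) (snd c p)))"

definition compact_riemannian_manifold ::
    "nat \<Rightarrow> 'e::euclidean_space set \<Rightarrow> ('m::{t2_space, second_countable_topology}, 'e) chart set \<Rightarrow>
     (('m, 'e) chart \<Rightarrow> 'm \<Rightarrow> 'e \<Rightarrow> 'e \<Rightarrow> real) \<Rightarrow> bool" where
  "compact_riemannian_manifold k V A g \<longleftrightarrow>
     compact (UNIV :: 'm set) \<and> ck_structure k V A \<and> riemannian_metric k V A g"

definition ck_function ::
    "nat \<Rightarrow> 'e::euclidean_space set \<Rightarrow> ('m, 'e) chart set \<Rightarrow> ('m \<Rightarrow> 'f::real_normed_vector) \<Rightarrow> bool" where
  "ck_function k V A f \<longleftrightarrow> (\<forall>c\<in>A. ck_on V k (chart_image c) (local_rep c f))"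

definition ck_map ::
    "nat \<Rightarrow> 'd::euclidean_space set \<Rightarrow> ('x::topological_space, 'd) chart set \<Rightarrow>
     ('m::topological_space, 'e::euclidean_space) chart set \<Rightarrow> ('x \<Rightarrow> 'm) \<Rightarrow> bool" where
  "ck_map k V A A' f \<longleftrightarrow> continuous_on UNIV f \<and>
     (\<forall>c\<in>A. \<forall>d\<in>A'. ck_on V k (snd c ` (fst c \<inter> f -` fst d)) (local_rep c (snd d \<circ> f)))"

definition ck_embedding ::
    "nat \<Rightarrow> 'e::euclidean_space set \<Rightarrow> ('m::topological_space, 'e) chart set \<Rightarrow>
     ('m \<Rightarrow> 'f::euclidean_space) \<Rightarrow> bool" where
  "ck_embedding k V A \<iota> \<longleftrightarrow> embedding_map euclidean euclidean \<iota> \<and> ck_function k V A \<iota> \<and>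
     (\<forall>c\<in>A. \<forall>p\<in>fst c. inj_on (\<lambda>v. dir_deriv v (local_rep c \<iota>) (snd c p)) V)"

text \<open>
  The \<open>C\<^sup>k\<close>-seminorm of \<open>F\<close> with respect to an atlas \<open>B\<close>: the supremum over all charts of the operator norms
  of the derivatives of order \<open>1, \<dots>, k\<close> of the coordinate expression of \<open>F\<close> (it may be infinite).
\<close>

definition ck_seminorm ::
    "nat \<Rightarrow> 'e::euclidean_space set \<Rightarrow> ('m, 'e) chart set \<Rightarrow> ('m \<Rightarrow> 'f::real_normed_vector) \<Rightarrow> ennreal" where
  "ck_seminorm k V B F = Sup {ennreal (norm (iter_dir_deriv vs (local_rep c F) y)) | c y vs.
     c \<in> B \<and> y \<in> chart_image c \<and> set vs \<subseteq> V \<inter> cball 0 1 \<and> length vs \<in> {1..k}}"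

definition isomorphic_mod_0 :: "'a measure \<Rightarrow> 'b measure \<Rightarrow> bool" where
  "isomorphic_mod_0 P Q \<longleftrightarrow> (\<exists>A B f.
     A \<in> sets P \<and> space P - A \<in> null_sets P \<and> B \<in> sets Q \<and> space Q - B \<in> null_sets Q \<and>
     bij_betw f A B \<and>
     f \<in> restrict_space P A \<rightarrow>\<^sub>M restrict_space Q B \<and>
     inv_into A f \<in> restrict_space Q B \<rightarrow>\<^sub>M restrict_space P A \<and>
     distr (restrict_space P A) (restrict_space Q B) f = restrict_space Q B)"

text \<open>
  A complete probability space isomorphic mod 0 to the disjoint union of an interval \<open>[0, s]\<close> with
  Lebesgue measure and countably many atoms. The atoms, of masses \<open>w 0, w 1, \<dots>\<close> (possibly \<open>0\<close>), are
  placed at the points \<open>-1, -2, \<dots>\<close> of the real line; the rest of the line is a null set.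
\<close>

definition rochlin_lebesgue_space :: "'w measure \<Rightarrow> bool" where
  "rochlin_lebesgue_space P \<longleftrightarrow> prob_space P \<and> complete_measure P \<and>
     (\<exists>(Q :: real measure) (s :: real) (w :: nat \<Rightarrow> real).
        0 \<le> s \<and> (\<forall>i. 0 \<le> w i) \<and> prob_space Q \<and> sets Q = sets borel \<and>
        (\<forall>A\<in>sets borel. emeasure Q A =
           emeasure lborel (A \<inter> {0..s}) + (\<Sum>i. ennreal (w i) * indicator A (- real (Suc i)))) \<and>
        isomorphic_mod_0 P (completion Q))"

text \<open>
  \<open>A\<close> and \<open>A'\<close> are the \<open>C\<^sup>k\<close> structures of \<open>'x\<close> and \<open>'m\<close>, \<open>B\<close> is the fixed finite atlas of \<open>'x\<close> and \<open>\<iota>\<close> the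
  fixed embedding of \<open>'m\<close> used to compute seminorms. Since one cannot quantify existentially over
  types, the type \<open>'w\<close> of the elements of the probability space is a parameter.
\<close>

definition boundedly_ck_representable ::
    "'w itself \<Rightarrow> nat \<Rightarrow> 'd::euclidean_space set \<Rightarrow> ('x::topological_space, 'd) chart set \<Rightarrow> ('x, 'd) chart set \<Rightarrow>
     ('m::topological_space, 'e::euclidean_space) chart set \<Rightarrow> ('m \<Rightarrow> 'f::euclidean_space) \<Rightarrow>
     ('x \<Rightarrow> 'm measure) \<Rightarrow> bool" where
  "boundedly_ck_representable _ k V A B A' \<iota> \<mu> \<longleftrightarrow>
     (\<exists>(P :: 'w measure) (T :: 'x \<times> 'w \<Rightarrow> 'm) (C :: real).
        rochlin_lebesgue_space P \<and> T \<in> borel \<Otimes>\<^sub>M P \<rightarrow>\<^sub>M borel \<and> C > 0 \<and>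
        (\<forall>x. distr P borel (\<lambda>\<omega>. T (x, \<omega>)) = \<mu> x) \<and>
        (\<forall>\<omega>\<in>space P. ck_map k V A A' (\<lambda>x. T (x, \<omega>)) \<and>
           ck_seminorm k V B (\<lambda>x. \<iota> (T (x, \<omega>))) \<le> ennreal C))"

end

theory Submission
  imports Defs
begin

text \<open>
  Write \<open>T\<^sub>\<omega> x\<close> for \<open>T (x, \<omega>)\<close>. Since \<open>\<mu> x\<close> is the image of \<open>P\<close> under \<open>\<omega> \<mapsto> T\<^sub>\<omega> x\<close>, the average of \<open>h\<close> is
  \<open>\<integral> h (T\<^sub>\<omega> x) \<partial>P\<close>, and the theorem is an instance of differentiation under the integral sign. By
  dominated convergence this needs no more than a bound, locally in \<open>x\<close> and uniform in \<open>\<omega>\<close>, for the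
  derivatives up to order \<open>k\<close> of the functions \<open>h \<circ> T\<^sub>\<omega>\<close> in a chart of \<open>X\<close>; the continuity
  of the derivatives of order \<open>k\<close> for each single \<open>\<omega>\<close> is inherited by the integral (\<open>ck_on_integral\<close>).

  The hypothesis bounds only the derivatives of \<open>\<iota> \<circ> T\<^sub>\<omega>\<close>. The passage from \<open>\<iota>\<close> to an arbitrary \<open>h\<close> uses a
  gradient instead of an extension of \<open>h\<close> to a neighbourhood of \<open>\<iota> M\<close>. As the differential of \<open>\<iota>\<close> is
  injective, at each point \<open>p\<close> of \<open>M\<close> there is exactly one vector \<open>a p\<close> in its range such that
  \<open>dh = a p \<bullet> d\<iota>\<close> at \<open>p\<close>. It does not depend on a chart, and in a chart it solves a linear system whose
  coefficients are derivatives of \<open>h\<close> and \<open>\<iota>\<close>; so if \<open>h\<close> is of class \<open>C\<^sup>j\<^sup>+\<^sup>1\<close> then \<open>a\<close> is a function of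
  class \<open>C\<^sup>j\<close> on \<open>M\<close> (\<open>gradient_of_ck_function\<close>). The chain rule becomes
  \<open>D\<^sub>v (h \<circ> T\<^sub>\<omega>) = (a \<circ> T\<^sub>\<omega>) \<bullet> D\<^sub>v (\<iota> \<circ> T\<^sub>\<omega>)\<close>.
  Induction on \<open>j\<close> now shows that for every \<open>f\<close> of class \<open>C\<^sup>j\<close> the family \<open>f \<circ> T\<^sub>\<omega>\<close> has uniformly bounded
  derivatives up to order \<open>j\<close>: order \<open>0\<close> is the compactness of \<open>M\<close>, and in the step the induction
  hypothesis applies to the components of \<open>a\<close> (\<open>equibounded_ck_compose\<close>).

  All this takes place in the charts of the finite atlas \<open>B\<close>, where the seminorm is computed; the
  remaining charts are reached by composition with changes of charts. As regularity is defined
  through directional derivatives, the chain rule itself has to be derived: continuous directional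
  derivatives give a Frechet derivative within \<open>V\<close> (\<open>ck_on_1_has_derivative_within\<close>).
\<close>

section \<open>Directional derivatives on relatively open sets\<close>

lemma has_vector_derivative_dir_deriv:
  assumes "(\<lambda>t. f (x + t *\<^sub>R v)) differentiable (at 0)"
  shows "((\<lambda>t. f (x + t *\<^sub>R v)) has_vector_derivative dir_deriv v f x) (at 0)"
  using assms by (simp add: dir_deriv_def vector_derivative_works)

lemma dir_deriv_eqI:
  assumes "((\<lambda>t. f (x + t *\<^sub>R v)) has_vector_derivative D) (at 0)"
  shows "dir_deriv v f x = D"
  using assms by (simp add: dir_deriv_def vector_derivative_at)

lemma differentiable_if_has_vector_derivative:
  "(f has_vector_derivative D) F \<Longrightarrow> f differentiable F"
  using differentiable_def has_vector_derivative_def by blast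

text \<open>
  Directional derivatives at a point of \<open>U\<close> see only values of the function on \<open>U\<close>.
\<close>

lemma eventually_line_in:
  fixes x :: "'e::real_normed_vector"
  assumes "subspace V" "openin (top_of_set V) U" "x \<in> U" "v \<in> V"
  shows "\<forall>\<^sub>F t in nhds (0::real). x + t *\<^sub>R v \<in> U"
proof -
  obtain O' where O: "open O'" "U = V \<inter> O'"
    using assms(2) by (auto simp: openin_open)
  have xV: "x \<in> V" and xO: "x \<in> O'" using assms(3) O by auto
  have "((\<lambda>t. x + t *\<^sub>R v) \<longlongrightarrow> x + 0 *\<^sub>R v) (nhds (0::real))"
    by (intro tendsto_intros filterlim_ident)
  then have "\<forall>\<^sub>F t in nhds (0::real). x + t *\<^sub>R v \<in> O'"
    using O(1) xO by (auto dest: topological_tendstoD)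
  then show ?thesis
    by eventually_elim (use O xV assms in \<open>auto intro: subspace_add subspace_scale\<close>)
qed

lemma has_vector_derivative_cong_line:
  fixes x :: "'e::real_normed_vector"
  assumes "subspace V" "openin (top_of_set V) U" "x \<in> U" "v \<in> V"
    and "\<And>y. y \<in> U \<Longrightarrow> f y = g y"
    and "((\<lambda>t. f (x + t *\<^sub>R v)) has_vector_derivative D) (at 0)"
  shows "((\<lambda>t. g (x + t *\<^sub>R v)) has_vector_derivative D) (at 0)"
proof -
  have "\<forall>\<^sub>F t in nhds (0::real). f (x + t *\<^sub>R v) = g (x + t *\<^sub>R v)"
    using eventually_line_in[OF assms(1-4)] by eventually_elim (simp add: assms(5))
  then obtain S where "open S" "0 \<in> S" "\<And>t. t \<in> S \<Longrightarrow> f (x + t *\<^sub>R v) = g (x + t *\<^sub>R v)"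
    by (auto simp: eventually_nhds)
  then show ?thesis
    using has_vector_derivative_transform_within_open[OF assms(6), of S] by auto
qed

lemma has_vector_derivative_along_line:
  fixes x :: "'e::real_normed_vector"
  assumes "(\<lambda>t. f ((x + s *\<^sub>R v) + t *\<^sub>R v)) differentiable (at 0)"
  shows "((\<lambda>t. f (x + t *\<^sub>R v)) has_vector_derivative dir_deriv v f (x + s *\<^sub>R v)) (at s)"
proof -
  have 1: "((\<lambda>t::real. t - s) has_vector_derivative 1) (at s)"
    by (auto intro!: derivative_eq_intros)
  have 2: "((\<lambda>t. f ((x + s *\<^sub>R v) + t *\<^sub>R v)) has_vector_derivative dir_deriv v f (x + s *\<^sub>R v)) (at (s - s))"
    using has_vector_derivative_dir_deriv[OF assms] by simp
  have "(\<lambda>t. f ((x + s *\<^sub>R v) + t *\<^sub>R v)) \<circ> (\<lambda>t. t - s) = (\<lambda>t. f (x + t *\<^sub>R v))"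
    by (auto simp: fun_eq_iff algebra_simps)
  then show ?thesis
    using vector_diff_chain_at[OF 1 2] by simp
qed

text \<open>
  The form with a comparison vector \<open>D\<close> gives both the Lipschitz estimate (\<open>D = 0\<close>) and the error of the
  linear approximation at a point (\<open>D\<close> the derivative there).
\<close>

lemma dir_deriv_mean_value:
  fixes x :: "'e::real_normed_vector" and f :: "'e \<Rightarrow> 'f::real_normed_vector"
  assumes "\<And>t. t \<in> closed_segment 0 s \<Longrightarrow> (\<lambda>r. f ((x + t *\<^sub>R v) + r *\<^sub>R v)) differentiable (at 0)"
    and "\<And>t. t \<in> closed_segment 0 s \<Longrightarrow> norm (dir_deriv v f (x + t *\<^sub>R v) - D) \<le> K"
  shows "norm (f (x + s *\<^sub>R v) - f x - s *\<^sub>R D) \<le> K * \<bar>s\<bar>"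
proof -
  define g where "g t = f (x + t *\<^sub>R v) - t *\<^sub>R D" for t
  have der: "(g has_vector_derivative dir_deriv v f (x + t *\<^sub>R v) - D) (at t within closed_segment 0 s)"
    if "t \<in> closed_segment 0 s" for t
  proof -
    have "((\<lambda>t. t *\<^sub>R D) has_vector_derivative D) (at t)"
      by (auto intro!: derivative_eq_intros simp: has_vector_derivative_def)
    then have "(g has_vector_derivative dir_deriv v f (x + t *\<^sub>R v) - D) (at t)"
      unfolding g_def using has_vector_derivative_along_line[OF assms(1)[OF that]]
      by (intro has_vector_derivative_diff)
    then show ?thesis by (rule has_vector_derivative_at_within)
  qed
  have "norm (g s - g 0) \<le> K * norm (s - 0)"
  proof (rule differentiable_bound[of "closed_segment 0 s" g])
    fix t assume t: "t \<in> closed_segment 0 s"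
    show "(g has_derivative (\<lambda>r. r *\<^sub>R (dir_deriv v f (x + t *\<^sub>R v) - D))) (at t within closed_segment 0 s)"
      using der[OF t] by (simp add: has_vector_derivative_def)
    have "K \<ge> 0" using assms(2)[OF t] norm_ge_zero order_trans by blast
    moreover have "norm (r *\<^sub>R (dir_deriv v f (x + t *\<^sub>R v) - D)) \<le> K * norm r" for r :: real
      using mult_right_mono[OF assms(2)[OF t], of "\<bar>r\<bar>"] by (simp add: mult.commute)
    ultimately show "onorm (\<lambda>r. r *\<^sub>R (dir_deriv v f (x + t *\<^sub>R v) - D)) \<le> K"
      by (rule onorm_bound)
  qed auto
  then show ?thesis by (simp add: g_def algebra_simps)
qed

section \<open>Families of functions with locally uniformly bounded derivatives\<close>

text \<open>
  Bounds are required locally in the variable and uniformly in the index, whereas continuity is required of each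
  member separately. A family of equal continuous functions thus satisfies this condition automatically, so that facts on
  families of \<open>C\<^sup>k\<close> functions specialize to facts on single ones (\<open>equibounded_ck_single_iff\<close>).
\<close>

definition equibounded_continuous ::
    "'e::real_normed_vector set \<Rightarrow> 'w set \<Rightarrow> ('w \<Rightarrow> 'e \<Rightarrow> 'f::real_normed_vector) \<Rightarrow> bool" where
  "equibounded_continuous U \<Omega> F \<longleftrightarrow> (\<forall>\<omega>\<in>\<Omega>. continuous_on U (F \<omega>)) \<and>
     (\<forall>x\<in>U. \<exists>N K. open N \<and> x \<in> N \<and> (\<forall>\<omega>\<in>\<Omega>. \<forall>y\<in>N \<inter> U. norm (F \<omega> y) \<le> K))"

primrec equibounded_ck ::
    "'e::real_normed_vector set \<Rightarrow> nat \<Rightarrow> 'e set \<Rightarrow> 'w set \<Rightarrow> ('w \<Rightarrow> 'e \<Rightarrow> 'f::real_normed_vector) \<Rightarrow> bool" where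
  "equibounded_ck V 0 U \<Omega> F \<longleftrightarrow> equibounded_continuous U \<Omega> F"
| "equibounded_ck V (Suc k) U \<Omega> F \<longleftrightarrow> equibounded_continuous U \<Omega> F \<and>
     (\<forall>v\<in>V. (\<forall>\<omega>\<in>\<Omega>. \<forall>x\<in>U. (\<lambda>t. F \<omega> (x + t *\<^sub>R v)) differentiable (at 0)) \<and>
        equibounded_ck V k U \<Omega> (\<lambda>\<omega>. dir_deriv v (F \<omega>)))"

lemma equibounded_continuousI:
  assumes "\<And>\<omega>. \<omega> \<in> \<Omega> \<Longrightarrow> continuous_on U (F \<omega>)"
    and "\<And>\<omega> y. \<omega> \<in> \<Omega> \<Longrightarrow> y \<in> U \<Longrightarrow> norm (F \<omega> y) \<le> K"
  shows "equibounded_continuous U \<Omega> F"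
  unfolding equibounded_continuous_def using assms by (auto intro!: exI[of _ UNIV] exI[of _ K])

lemma equibounded_continuousE:
  assumes "equibounded_continuous U \<Omega> F" "x \<in> U"
  obtains N K where "open N" "x \<in> N" "\<forall>\<omega>\<in>\<Omega>. \<forall>y\<in>N \<inter> U. norm (F \<omega> y) \<le> K"
  using assms unfolding equibounded_continuous_def by blast

lemma equibounded_continuous_cong:
  assumes "\<And>\<omega> y. \<omega> \<in> \<Omega> \<Longrightarrow> y \<in> U \<Longrightarrow> F \<omega> y = G \<omega> y"
  shows "equibounded_continuous U \<Omega> F \<longleftrightarrow> equibounded_continuous U \<Omega> G"
proof -
  have "continuous_on U (F \<omega>) \<longleftrightarrow> continuous_on U (G \<omega>)" if "\<omega> \<in> \<Omega>" for \<omega>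
    using assms that by (intro continuous_on_cong) auto
  then show ?thesis
    unfolding equibounded_continuous_def using assms by simp
qed

lemma equibounded_ck_imp_continuous: "equibounded_ck V k U \<Omega> F \<Longrightarrow> equibounded_continuous U \<Omega> F"
  by (cases k) auto

lemma equibounded_ck_imp_ck_on: "equibounded_ck V k U \<Omega> F \<Longrightarrow> \<omega> \<in> \<Omega> \<Longrightarrow> ck_on V k U (F \<omega>)"
proof (induction k arbitrary: F)
  case (Suc k)
  have "ck_on V k U (dir_deriv v (F \<omega>))" if "v \<in> V" for v
    using Suc.IH[of "\<lambda>\<omega>. dir_deriv v (F \<omega>)"] Suc.prems that by simp
  then show ?case using Suc.prems by (simp add: equibounded_continuous_def)
qed (simp add: equibounded_continuous_def)

lemma equibounded_continuous_const_family:
  assumes "continuous_on U f"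
  shows "equibounded_continuous U \<Omega> (\<lambda>_. f)"
  unfolding equibounded_continuous_def
proof (intro conjI ballI)
  fix x assume x: "x \<in> U"
  obtain d where d: "d > 0" "\<And>y. y \<in> U \<Longrightarrow> dist y x < d \<Longrightarrow> dist (f y) (f x) < 1"
    using assms x unfolding continuous_on_iff by (meson zero_less_one)
  have "norm (f y) \<le> 1 + norm (f x)" if "y \<in> ball x d \<inter> U" for y
    using d(2)[of y] that norm_triangle_sub[of "f y" "f x"] by (auto simp: dist_norm dist_commute norm_minus_commute)
  then show "\<exists>N K. open N \<and> x \<in> N \<and> (\<forall>\<omega>\<in>\<Omega>. \<forall>y\<in>N \<inter> U. norm (f y) \<le> K)"
    using d(1) by (intro exI[of _ "ball x d"] exI[of _ "1 + norm (f x)"]) auto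
qed (use assms in auto)

lemma equibounded_ck_const_family: "ck_on V k U f \<Longrightarrow> equibounded_ck V k U \<Omega> (\<lambda>_. f)"
  by (induction k arbitrary: f) (auto simp: equibounded_continuous_const_family)

lemma equibounded_ck_single_iff: "equibounded_ck V k U {()} (\<lambda>_. f) \<longleftrightarrow> ck_on V k U f"
  by (metis equibounded_ck_const_family equibounded_ck_imp_ck_on insertI1)

lemma equibounded_ck_le:
  "equibounded_ck V k U \<Omega> F \<Longrightarrow> m \<le> k \<Longrightarrow> equibounded_ck V m U \<Omega> F"
proof (induction k arbitrary: m F)
  case (Suc k)
  then show ?case by (cases m) auto
qed auto

lemma ck_on_le: "ck_on V k U f \<Longrightarrow> m \<le> k \<Longrightarrow> ck_on V m U f"
  using equibounded_ck_le[of V k U "{()}" "\<lambda>_. f" m] by (simp add: equibounded_ck_single_iff)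

lemma ck_on_imp_continuous_on: "ck_on V k U f \<Longrightarrow> continuous_on U f"
  by (cases k) auto

lemma equibounded_ck_cong:
  fixes F G :: "'w \<Rightarrow> 'e::real_normed_vector \<Rightarrow> 'f::real_normed_vector"
  assumes "subspace V" "openin (top_of_set V) U"
    and "\<And>\<omega> y. \<omega> \<in> \<Omega> \<Longrightarrow> y \<in> U \<Longrightarrow> F \<omega> y = G \<omega> y"
    and "equibounded_ck V k U \<Omega> F"
  shows "equibounded_ck V k U \<Omega> G"
  using assms(3,4)
proof (induction k arbitrary: F G)
  case 0
  then show ?case using equibounded_continuous_cong[of \<Omega> U F G] by simp
next
  case (Suc k)
  have der: "((\<lambda>t. G \<omega> (x + t *\<^sub>R v)) has_vector_derivative dir_deriv v (F \<omega>) x) (at 0)"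
    if "v \<in> V" "\<omega> \<in> \<Omega>" "x \<in> U" for v \<omega> x
    using Suc.prems(1)[OF that(2)]
  proof (rule has_vector_derivative_cong_line[OF assms(1,2) that(3,1)])
    show "((\<lambda>t. F \<omega> (x + t *\<^sub>R v)) has_vector_derivative dir_deriv v (F \<omega>) x) (at 0)"
      using Suc.prems(2) that by (intro has_vector_derivative_dir_deriv) simp
  qed
  have "equibounded_ck V k U \<Omega> (\<lambda>\<omega>. dir_deriv v (G \<omega>))" if v: "v \<in> V" for v
  proof (rule Suc.IH)
    show "equibounded_ck V k U \<Omega> (\<lambda>\<omega>. dir_deriv v (F \<omega>))" using Suc.prems(2) v by simp
    show "dir_deriv v (F \<omega>) y = dir_deriv v (G \<omega>) y" if "\<omega> \<in> \<Omega>" "y \<in> U" for \<omega> y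
      using dir_deriv_eqI[OF der[OF v that]] by (rule sym)
  qed
  moreover have "equibounded_continuous U \<Omega> G"
    using equibounded_continuous_cong[of \<Omega> U F G, OF Suc.prems(1)] Suc.prems(2) by simp
  moreover have "(\<lambda>t. G \<omega> (x + t *\<^sub>R v)) differentiable (at 0)" if "v \<in> V" "\<omega> \<in> \<Omega>" "x \<in> U" for v \<omega> x
    using der[OF that] by (rule differentiable_if_has_vector_derivative)
  ultimately show ?case by simp
qed

lemma ck_on_cong:
  fixes f g :: "'e::real_normed_vector \<Rightarrow> 'f::real_normed_vector"
  assumes "subspace V" "openin (top_of_set V) U"
    and "\<And>y. y \<in> U \<Longrightarrow> f y = g y" and "ck_on V k U f"
  shows "ck_on V k U g"
  using equibounded_ck_cong[of V U "{()}" "\<lambda>_. f" "\<lambda>_. g" k] assms by (simp add: equibounded_ck_single_iff)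

text \<open>
  In an induction on the order, a derivative is known by a formula valid on \<open>U\<close> only; the rule replaces
  \<open>dir_deriv\<close> by that formula.
\<close>

lemma equibounded_ck_SucI:
  fixes F :: "'w \<Rightarrow> 'e::real_normed_vector \<Rightarrow> 'f::real_normed_vector"
  assumes "subspace V" "openin (top_of_set V) U" "equibounded_continuous U \<Omega> F"
    and "\<And>v \<omega> x. v \<in> V \<Longrightarrow> \<omega> \<in> \<Omega> \<Longrightarrow> x \<in> U \<Longrightarrow>
          ((\<lambda>t. F \<omega> (x + t *\<^sub>R v)) has_vector_derivative D v \<omega> x) (at 0)"
    and "\<And>v. v \<in> V \<Longrightarrow> equibounded_ck V k U \<Omega> (D v)"
  shows "equibounded_ck V (Suc k) U \<Omega> F"
proof -
  have "equibounded_ck V k U \<Omega> (\<lambda>\<omega>. dir_deriv v (F \<omega>))" if v: "v \<in> V" for v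
    using dir_deriv_eqI[OF assms(4)[OF v], symmetric] assms(5)[OF v]
    by (rule equibounded_ck_cong[OF assms(1,2)])
  moreover have "(\<lambda>t. F \<omega> (x + t *\<^sub>R v)) differentiable (at 0)" if "v \<in> V" "\<omega> \<in> \<Omega>" "x \<in> U" for v \<omega> x
    using assms(4)[OF that] by (rule differentiable_if_has_vector_derivative)
  ultimately show ?thesis using assms(3) by simp
qed

lemma equibounded_ck_SucD:
  assumes "equibounded_ck V (Suc k) U \<Omega> F" "v \<in> V"
  shows "equibounded_ck V k U \<Omega> (\<lambda>\<omega>. dir_deriv v (F \<omega>))"
    and "\<omega> \<in> \<Omega> \<Longrightarrow> x \<in> U \<Longrightarrow>
         ((\<lambda>t. F \<omega> (x + t *\<^sub>R v)) has_vector_derivative dir_deriv v (F \<omega>) x) (at 0)"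
  using assms by (auto intro: has_vector_derivative_dir_deriv)

lemma ck_on_SucD:
  assumes "ck_on V (Suc k) U f" "v \<in> V"
  shows "ck_on V k U (dir_deriv v f)"
    and "x \<in> U \<Longrightarrow> ((\<lambda>t. f (x + t *\<^sub>R v)) has_vector_derivative dir_deriv v f x) (at 0)"
  using assms by (auto intro: has_vector_derivative_dir_deriv)

lemma ck_on_SucI:
  fixes f :: "'e::real_normed_vector \<Rightarrow> 'f::real_normed_vector"
  assumes "subspace V" "openin (top_of_set V) U" "continuous_on U f"
    and "\<And>v x. v \<in> V \<Longrightarrow> x \<in> U \<Longrightarrow> ((\<lambda>t. f (x + t *\<^sub>R v)) has_vector_derivative D v x) (at 0)"
    and "\<And>v. v \<in> V \<Longrightarrow> ck_on V k U (D v)"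
  shows "ck_on V (Suc k) U f"
  using equibounded_ck_SucI[of V U "{()}" "\<lambda>_. f" "\<lambda>v _. D v" k] assms
  by (simp only: equibounded_ck_single_iff equibounded_continuous_const_family)

lemma equibounded_continuous_add:
  assumes "equibounded_continuous U \<Omega> F" "equibounded_continuous U \<Omega> G"
  shows "equibounded_continuous U \<Omega> (\<lambda>\<omega> y. F \<omega> y + G \<omega> y)"
  unfolding equibounded_continuous_def
proof (intro conjI ballI)
  fix x assume x: "x \<in> U"
  obtain M K where M: "open M" "x \<in> M" "\<forall>\<omega>\<in>\<Omega>. \<forall>y\<in>M \<inter> U. norm (F \<omega> y) \<le> K"
    using equibounded_continuousE[OF assms(1) x] .
  obtain N L where N: "open N" "x \<in> N" "\<forall>\<omega>\<in>\<Omega>. \<forall>y\<in>N \<inter> U. norm (G \<omega> y) \<le> L"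
    using equibounded_continuousE[OF assms(2) x] .
  show "\<exists>N K. open N \<and> x \<in> N \<and> (\<forall>\<omega>\<in>\<Omega>. \<forall>y\<in>N \<inter> U. norm (F \<omega> y + G \<omega> y) \<le> K)"
    using M N by (intro exI[of _ "M \<inter> N"] exI[of _ "K + L"]) (auto intro!: norm_triangle_le add_mono)
qed (use assms in \<open>auto simp: equibounded_continuous_def intro: continuous_on_add\<close>)

lemma (in bounded_bilinear) equibounded_continuous_prod:
  assumes "equibounded_continuous U \<Omega> F" "equibounded_continuous U \<Omega> G"
  shows "equibounded_continuous U \<Omega> (\<lambda>\<omega> y. prod (F \<omega> y) (G \<omega> y))"
  unfolding equibounded_continuous_def
proof (intro conjI ballI)
  fix x assume x: "x \<in> U"
  obtain M K where M: "open M" "x \<in> M" "\<forall>\<omega>\<in>\<Omega>. \<forall>y\<in>M \<inter> U. norm (F \<omega> y) \<le> K"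
    using equibounded_continuousE[OF assms(1) x] .
  obtain N L where N: "open N" "x \<in> N" "\<forall>\<omega>\<in>\<Omega>. \<forall>y\<in>N \<inter> U. norm (G \<omega> y) \<le> L"
    using equibounded_continuousE[OF assms(2) x] .
  obtain C where C: "C > 0" "\<And>a b. norm (prod a b) \<le> norm a * norm b * C"
    using pos_bounded by blast
  have "norm (prod (F \<omega> y) (G \<omega> y)) \<le> K * L * C" if "\<omega> \<in> \<Omega>" "y \<in> M \<inter> N \<inter> U" for \<omega> y
  proof -
    have "norm (F \<omega> y) \<le> K" "norm (G \<omega> y) \<le> L" using M N that by auto
    then have "norm (F \<omega> y) * norm (G \<omega> y) * C \<le> K * L * C"
      using C(1) norm_ge_zero[of "F \<omega> y"] norm_ge_zero[of "G \<omega> y"]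
      by (intro mult_right_mono mult_mono) linarith+
    then show ?thesis using C(2) order_trans by blast
  qed
  then show "\<exists>N K. open N \<and> x \<in> N \<and> (\<forall>\<omega>\<in>\<Omega>. \<forall>y\<in>N \<inter> U. norm (prod (F \<omega> y) (G \<omega> y)) \<le> K)"
    using M N by (intro exI[of _ "M \<inter> N"] exI[of _ "K * L * C"]) auto
qed (use assms continuous_on[of U] in \<open>auto simp: equibounded_continuous_def\<close>)

lemma equibounded_ck_add:
  fixes F G :: "'w \<Rightarrow> 'e::real_normed_vector \<Rightarrow> 'f::real_normed_vector"
  assumes "subspace V" "openin (top_of_set V) U"
    and "equibounded_ck V k U \<Omega> F" "equibounded_ck V k U \<Omega> G"
  shows "equibounded_ck V k U \<Omega> (\<lambda>\<omega> y. F \<omega> y + G \<omega> y)"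
  using assms(3,4)
proof (induction k arbitrary: F G)
  case (Suc k)
  show ?case
  proof (rule equibounded_ck_SucI[OF assms(1,2)])
    show "equibounded_continuous U \<Omega> (\<lambda>\<omega> y. F \<omega> y + G \<omega> y)"
      by (intro equibounded_continuous_add equibounded_ck_imp_continuous[OF Suc.prems(1)]
          equibounded_ck_imp_continuous[OF Suc.prems(2)])
    show "((\<lambda>t. F \<omega> (x + t *\<^sub>R v) + G \<omega> (x + t *\<^sub>R v)) has_vector_derivative
        dir_deriv v (F \<omega>) x + dir_deriv v (G \<omega>) x) (at 0)" if "v \<in> V" "\<omega> \<in> \<Omega>" "x \<in> U" for v \<omega> x
      using equibounded_ck_SucD(2)[OF Suc.prems(1) that] equibounded_ck_SucD(2)[OF Suc.prems(2) that]
      by (rule has_vector_derivative_add)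
    show "equibounded_ck V k U \<Omega> (\<lambda>\<omega> x. dir_deriv v (F \<omega>) x + dir_deriv v (G \<omega>) x)" if "v \<in> V" for v
      using equibounded_ck_SucD(1)[OF Suc.prems(1) that] equibounded_ck_SucD(1)[OF Suc.prems(2) that]
      by (rule Suc.IH)
  qed
qed (simp add: equibounded_continuous_add)

text \<open>
  The bilinear form covers products, scalar multiplication and inner products at once, and with a
  constant factor also composition with linear functionals.
\<close>

lemma (in bounded_bilinear) equibounded_ck_prod:
  fixes F :: "'w \<Rightarrow> 'e::real_normed_vector \<Rightarrow> 'a"
  assumes "subspace V" "openin (top_of_set V) U"
    and "equibounded_ck V k U \<Omega> F" "equibounded_ck V k U \<Omega> G"
  shows "equibounded_ck V k U \<Omega> (\<lambda>\<omega> y. prod (F \<omega> y) (G \<omega> y))"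
  using assms(3,4)
proof (induction k arbitrary: F G)
  case (Suc k)
  have der: "((\<lambda>t. prod (F \<omega> (x + t *\<^sub>R v)) (G \<omega> (x + t *\<^sub>R v))) has_vector_derivative
      prod (F \<omega> x) (dir_deriv v (G \<omega>) x) + prod (dir_deriv v (F \<omega>) x) (G \<omega> x)) (at 0)"
    if "v \<in> V" "\<omega> \<in> \<Omega>" "x \<in> U" for v \<omega> x
    using has_vector_derivative[OF equibounded_ck_SucD(2)[OF Suc.prems(1) that]
            equibounded_ck_SucD(2)[OF Suc.prems(2) that]] by simp
  have "equibounded_ck V k U \<Omega> F" "equibounded_ck V k U \<Omega> G"
    using Suc.prems equibounded_ck_le[of V "Suc k" U \<Omega> _ k] by auto
  note FG = this
  show ?case
  proof (rule equibounded_ck_SucI[OF assms(1,2) _ der])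
    show "equibounded_continuous U \<Omega> (\<lambda>\<omega> y. prod (F \<omega> y) (G \<omega> y))"
      by (intro equibounded_continuous_prod equibounded_ck_imp_continuous[OF FG(1)] equibounded_ck_imp_continuous[OF FG(2)])
    show "equibounded_ck V k U \<Omega> (\<lambda>\<omega> x. prod (F \<omega> x) (dir_deriv v (G \<omega>) x) + prod (dir_deriv v (F \<omega>) x) (G \<omega> x))"
      if "v \<in> V" for v
      by (intro equibounded_ck_add[OF assms(1,2)] Suc.IH FG equibounded_ck_SucD(1)[OF Suc.prems(1) that]
          equibounded_ck_SucD(1)[OF Suc.prems(2) that])
  qed auto
qed (simp add: equibounded_continuous_prod)

lemma (in bounded_bilinear) ck_on_prod:
  fixes f :: "'e::real_normed_vector \<Rightarrow> 'a"
  assumes "subspace V" "openin (top_of_set V) U" "ck_on V k U f" "ck_on V k U g"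
  shows "ck_on V k U (\<lambda>y. prod (f y) (g y))"
  using equibounded_ck_prod[of V U k "{()}" "\<lambda>_. f" "\<lambda>_. g"] assms by (simp add: equibounded_ck_single_iff)

lemma dir_deriv_const [simp]: "dir_deriv v (\<lambda>_. c) = (\<lambda>_. 0)"
  by (auto simp: dir_deriv_def)

lemma ck_on_const: "ck_on V k U (\<lambda>_. c)"
  by (induction k arbitrary: c) auto

lemma equibounded_ck_sum:
  fixes F :: "'i \<Rightarrow> 'w \<Rightarrow> 'e::real_normed_vector \<Rightarrow> 'f::real_normed_vector"
  assumes "subspace V" "openin (top_of_set V) U"
    and "\<And>i. i \<in> I \<Longrightarrow> equibounded_ck V k U \<Omega> (F i)"
  shows "equibounded_ck V k U \<Omega> (\<lambda>\<omega> y. \<Sum>i\<in>I. F i \<omega> y)"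
  using assms(3)
proof (induction I rule: infinite_finite_induct)
  case (insert i I)
  then show ?case by (simp add: equibounded_ck_add[OF assms(1,2)])
qed (simp_all add: equibounded_ck_const_family ck_on_const)

lemma ck_on_add:
  fixes f :: "'e::real_normed_vector \<Rightarrow> 'f::real_normed_vector"
  assumes "subspace V" "openin (top_of_set V) U" "ck_on V k U f" "ck_on V k U g"
  shows "ck_on V k U (\<lambda>y. f y + g y)"
  using equibounded_ck_add[of V U k "{()}" "\<lambda>_. f" "\<lambda>_. g"] assms by (simp add: equibounded_ck_single_iff)

lemma ck_on_sum:
  fixes f :: "'i \<Rightarrow> 'e::real_normed_vector \<Rightarrow> 'f::real_normed_vector"
  assumes "subspace V" "openin (top_of_set V) U" "\<And>i. i \<in> I \<Longrightarrow> ck_on V k U (f i)"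
  shows "ck_on V k U (\<lambda>y. \<Sum>i\<in>I. f i y)"
  using equibounded_ck_sum[of V U I k "{()}" "\<lambda>i _. f i"] assms by (simp add: equibounded_ck_single_iff)

lemma ck_on_minus:
  fixes f :: "'e::real_normed_vector \<Rightarrow> 'f::real_normed_vector"
  assumes "subspace V" "openin (top_of_set V) U" "ck_on V k U f"
  shows "ck_on V k U (\<lambda>y. - f y)"
  using bounded_bilinear.ck_on_prod[OF bounded_bilinear_scaleR assms(1,2) ck_on_const[of V k U "- 1"] assms(3)] by simp

lemma ck_on_inverse:
  fixes f :: "'e::real_normed_vector \<Rightarrow> real"
  assumes "subspace V" "openin (top_of_set V) U" "ck_on V k U f" "\<And>y. y \<in> U \<Longrightarrow> f y \<noteq> 0"
  shows "ck_on V k U (\<lambda>y. inverse (f y))"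
  using assms(3,4)
proof (induction k)
  case 0
  then show ?case by (auto intro: continuous_on_inverse)
next
  case (Suc k)
  have f: "ck_on V k U f" using ck_on_le[OF Suc.prems(1), of k] by simp
  have der: "((\<lambda>t. inverse (f (x + t *\<^sub>R v))) has_vector_derivative
       - (inverse (f x) * dir_deriv v f x * inverse (f x))) (at 0)" if "v \<in> V" "x \<in> U" for v x
    using ck_on_SucD(2)[OF Suc.prems(1) that] Suc.prems(2)[OF that(2)]
    unfolding has_real_derivative_iff_has_vector_derivative[symmetric]
    by (auto intro!: derivative_eq_intros)
  show ?case
  proof (rule ck_on_SucI[OF assms(1,2) _ der])
    show "continuous_on U (\<lambda>y. inverse (f y))"
      using ck_on_imp_continuous_on[OF f] Suc.prems(2) by (intro continuous_on_inverse) auto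
    have inv: "ck_on V k U (\<lambda>y. inverse (f y))" using f Suc.prems(2) by (rule Suc.IH)
    show "ck_on V k U (\<lambda>x. - (inverse (f x) * dir_deriv v f x * inverse (f x)))" if "v \<in> V" for v
      by (intro ck_on_minus[OF assms(1,2)] bounded_bilinear.ck_on_prod[OF bounded_bilinear_mult assms(1,2)]
          inv ck_on_SucD(1)[OF Suc.prems(1) that])
  qed auto
qed

lemma at_within_openin:
  assumes "openin (top_of_set V) U" "x \<in> U"
  shows "at x within U = at x within V"
proof -
  obtain S where "open S" "U = V \<inter> S" using assms(1) by (auto simp: openin_open)
  then show ?thesis using assms(2) by (intro at_within_nhd[of x S]) auto
qed

lemma continuous_on_local_openin:
  fixes f :: "'e::real_normed_vector \<Rightarrow> 'f::real_normed_vector"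
  assumes "U \<subseteq> V"
    and "\<And>x. x \<in> U \<Longrightarrow> \<exists>W. openin (top_of_set V) W \<and> x \<in> W \<and> continuous_on W f"
  shows "continuous_on U f"
proof -
  have "continuous (at x within U) f" if x: "x \<in> U" for x
  proof -
    obtain W where W: "openin (top_of_set V) W" "x \<in> W" "continuous_on W f" using assms(2)[OF x] by auto
    then have "continuous (at x within V) f"
      using at_within_openin[OF W(1,2)] by (metis continuous_on_eq_continuous_within)
    then show ?thesis using assms(1) continuous_within_subset by blast
  qed
  then show ?thesis by (simp add: continuous_on_eq_continuous_within)
qed

lemma ck_on_local:
  fixes f :: "'e::real_normed_vector \<Rightarrow> 'f::real_normed_vector"
  assumes "U \<subseteq> V"
    and "\<And>x. x \<in> U \<Longrightarrow> \<exists>W. openin (top_of_set V) W \<and> x \<in> W \<and> ck_on V k W f"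
  shows "ck_on V k U f"
  using assms(2)
proof (induction k arbitrary: f)
  case 0
  then show ?case by (auto intro: continuous_on_local_openin[OF assms(1)])
next
  case (Suc k)
  have "continuous_on U f"
    by (rule continuous_on_local_openin[OF assms(1)]) (use Suc.prems in fastforce)
  moreover have "ck_on V k U (dir_deriv v f)" if "v \<in> V" for v
    by (rule Suc.IH) (use Suc.prems that in fastforce)
  moreover have "(\<lambda>t. f (x + t *\<^sub>R v)) differentiable (at 0)" if "v \<in> V" "x \<in> U" for v x
    using Suc.prems[OF that(2)] that(1) by auto
  ultimately show ?case by simp
qed

section \<open>The chain rule\<close>

text \<open>
  Induction on the orthonormal directions: an increment is split into its components along \<open>c\<close> and
  orthogonal to \<open>c\<close>. The former is estimated by the mean value inequality and continuity of \<open>dir_deriv c f\<close>,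
  the latter by the induction hypothesis.
\<close>

lemma ck_on_1_linear_approximation:
  fixes f :: "'e::euclidean_space \<Rightarrow> 'f::real_normed_vector"
  assumes "subspace V" "openin (top_of_set V) U" "z \<in> U" "ck_on V 1 U f"
    and "finite S" "S \<subseteq> V" "pairwise orthogonal S" "\<And>b. b \<in> S \<Longrightarrow> norm b = 1" "e > 0"
  shows "\<exists>d>0. \<forall>w\<in>span S. norm w < d \<longrightarrow>
           norm (f (z + w) - f z - (\<Sum>b\<in>S. (w \<bullet> b) *\<^sub>R dir_deriv b f z)) \<le> e * norm w"
  using assms(5-)
proof (induction S arbitrary: e rule: finite_induct)
  case empty
  then show ?case by (auto intro!: exI[of _ 1])
next
  case (insert c S)
  have cV: "c \<in> V" and c1: "norm c = 1" using insert.prems by auto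
  have orth: "b \<bullet> c = 0" if "b \<in> S" for b
    using insert.prems(2) insert.hyps(2) that by (auto simp: pairwise_def orthogonal_def)
  have orth_span: "w \<bullet> c = 0" if "w \<in> span S" for w
    using that orth by (induction rule: span_induct_alt) (auto simp: inner_add_left)
  have "\<exists>d>0. \<forall>w\<in>span S. norm w < d \<longrightarrow>
           norm (f (z + w) - f z - (\<Sum>b\<in>S. (w \<bullet> b) *\<^sub>R dir_deriv b f z)) \<le> e / 4 * norm w"
  proof (rule insert.IH)
    show "pairwise orthogonal S" using insert.prems(2) by (rule pairwise_mono) auto
  qed (use insert.prems in auto)
  then obtain d1 where d1: "d1 > 0" "\<And>w. w \<in> span S \<Longrightarrow> norm w < d1 \<Longrightarrow>
       norm (f (z + w) - f z - (\<Sum>b\<in>S. (w \<bullet> b) *\<^sub>R dir_deriv b f z)) \<le> e / 4 * norm w" by blast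
  obtain r where r: "r > 0" "ball z r \<inter> V \<subseteq> U"
    using assms(2,3) unfolding openin_contains_ball by blast
  have cont: "continuous_on U (dir_deriv c f)" using assms(4) cV by simp
  have e4: "e / 4 > 0" using insert.prems by simp
  obtain d2 where d2: "d2 > 0" "\<And>y. y \<in> U \<Longrightarrow> dist y z < d2 \<Longrightarrow> dist (dir_deriv c f y) (dir_deriv c f z) < e / 4"
    using cont[unfolded continuous_on_iff, rule_format, OF assms(3) e4] by blast
  \<comment> \<open>All auxiliary increments below have norm at most \<open>3 * norm w\<close>.\<close>
  define d where "d = min d1 (min r d2) / 3"
  have d: "d > 0" "3 * d \<le> d1" "3 * d \<le> r" "3 * d \<le> d2" using d1(1) d2(1) r(1) by (auto simp: d_def)
  have zV: "z \<in> V" using assms(2,3) openin_imp_subset by blast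
  have SV: "span S \<subseteq> V" using insert.prems(1) assms(1) by (simp add: span_minimal)
  have "norm (f (z + w) - f z - (\<Sum>b\<in>insert c S. (w \<bullet> b) *\<^sub>R dir_deriv b f z)) \<le> e * norm w"
    if w: "w \<in> span (insert c S)" "norm w < d" for w
  proof -
    obtain s where s: "w - s *\<^sub>R c \<in> span S" using w(1) span_breakdown_eq by blast
    define u where "u = w - s *\<^sub>R c"
    have us: "u \<in> span S" and w_eq: "w = u + s *\<^sub>R c" using s by (auto simp: u_def)
    have cc: "c \<bullet> c = 1" using c1 by (simp add: dot_square_norm)
    have s_eq: "w \<bullet> c = s" using orth_span[OF us] cc by (simp add: w_eq inner_add_left)
    have s_le: "\<bar>s\<bar> \<le> norm w" using Cauchy_Schwarz_ineq2[of w c] s_eq c1 by simp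
    have u_le: "norm u \<le> 2 * norm w"
      using norm_triangle_ineq4[of w "s *\<^sub>R c"] s_le c1 by (simp add: u_def)
    have near: "z + u + t *\<^sub>R c \<in> U \<and> dist (z + u + t *\<^sub>R c) z < d2" if t: "t \<in> closed_segment 0 s" for t
    proof -
      have "\<bar>t\<bar> \<le> \<bar>s\<bar>" using t by (auto simp: closed_segment_eq_real_ivl split: if_splits)
      then have "norm (u + t *\<^sub>R c) \<le> 3 * norm w"
        using norm_triangle_ineq[of u "t *\<^sub>R c"] u_le s_le c1 by simp
      then have n: "norm (u + t *\<^sub>R c) < 3 * d" using w(2) by linarith
      have "u \<in> V" using us SV by blast
      then have "z + u + t *\<^sub>R c \<in> V" using zV cV assms(1) by (simp add: subspace_add subspace_scale)
      moreover have "dist (z + u + t *\<^sub>R c) z < 3 * d" using n by (simp add: dist_norm add.assoc)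
      ultimately have "z + u + t *\<^sub>R c \<in> ball z r \<inter> V" "dist (z + u + t *\<^sub>R c) z < d2"
        using d by (auto simp: dist_commute)
      then show ?thesis using r(2) by blast
    qed
    have "norm (f ((z + u) + s *\<^sub>R c) - f (z + u) - s *\<^sub>R dir_deriv c f z) \<le> e / 4 * \<bar>s\<bar>"
    proof (rule dir_deriv_mean_value)
      fix t assume t: "t \<in> closed_segment 0 s"
      show "(\<lambda>r. f (z + u + t *\<^sub>R c + r *\<^sub>R c)) differentiable at 0"
        using assms(4) near[OF t] cV by simp
      show "norm (dir_deriv c f (z + u + t *\<^sub>R c) - dir_deriv c f z) \<le> e / 4"
        using d2(2) near[OF t] by (auto simp: dist_norm intro: less_imp_le)
    qed
    then have 1: "norm (f (z + w) - f (z + u) - s *\<^sub>R dir_deriv c f z) \<le> e / 4 * norm w"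
      using order_trans[OF _ mult_left_mono[OF s_le less_imp_le[OF e4]]] by (simp add: w_eq add.assoc)
    have "norm u < d1" using u_le w(2) d by linarith
    then have 2: "norm (f (z + u) - f z - (\<Sum>b\<in>S. (u \<bullet> b) *\<^sub>R dir_deriv b f z)) \<le> e / 2 * norm w"
      using order_trans[OF d1(2)[OF us] mult_left_mono[OF u_le less_imp_le[OF e4]]] by simp
    have "(\<Sum>b\<in>S. (w \<bullet> b) *\<^sub>R dir_deriv b f z) = (\<Sum>b\<in>S. (u \<bullet> b) *\<^sub>R dir_deriv b f z)"
      using orth by (intro sum.cong) (auto simp: w_eq inner_add_left inner_commute[of c])
    then have "f (z + w) - f z - (\<Sum>b\<in>insert c S. (w \<bullet> b) *\<^sub>R dir_deriv b f z) =
        (f (z + w) - f (z + u) - s *\<^sub>R dir_deriv c f z) + (f (z + u) - f z - (\<Sum>b\<in>S. (u \<bullet> b) *\<^sub>R dir_deriv b f z))"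
      using insert.hyps s_eq by simp
    then have "norm (f (z + w) - f z - (\<Sum>b\<in>insert c S. (w \<bullet> b) *\<^sub>R dir_deriv b f z)) \<le> e / 4 * norm w + e / 2 * norm w"
      using norm_triangle_mono[OF 1 2] by (simp only:)
    also have "\<dots> \<le> e * norm w" using e4 by (simp add: field_simps)
    finally show ?thesis .
  qed
  then show ?case using d(1) by blast
qed

definition orthonormal_basis_of :: "'e::euclidean_space set \<Rightarrow> 'e set \<Rightarrow> bool" where
  "orthonormal_basis_of V S \<longleftrightarrow>
     finite S \<and> S \<subseteq> V \<and> span S = V \<and> pairwise orthogonal S \<and> (\<forall>b\<in>S. norm b = 1) \<and> independent S"

lemma orthonormal_basis_exists:
  assumes "subspace V"
  obtains S where "orthonormal_basis_of V S"
proof (rule orthonormal_basis_subspace[OF assms])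
  fix S assume "S \<subseteq> V" "pairwise orthogonal S" "\<And>x. x \<in> S \<Longrightarrow> norm x = 1"
    "independent S" "span S = V"
  then show thesis
    by (intro that[of S]) (simp add: orthonormal_basis_of_def independent_imp_finite)
qed

lemma ck_on_1_has_derivative_within:
  fixes f :: "'e::euclidean_space \<Rightarrow> 'f::real_normed_vector"
  assumes "subspace V" "openin (top_of_set V) U" "z \<in> U" "ck_on V 1 U f" "orthonormal_basis_of V S"
  shows "(f has_derivative (\<lambda>w. \<Sum>b\<in>S. (w \<bullet> b) *\<^sub>R dir_deriv b f z)) (at z within V)"
proof -
  have S: "finite S" "S \<subseteq> V" "span S = V" "pairwise orthogonal S" "\<And>b. b \<in> S \<Longrightarrow> norm b = 1"
    using assms(5) by (auto simp: orthonormal_basis_of_def)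
  have zV: "z \<in> V" using assms(2,3) openin_imp_subset by blast
  have "\<exists>d>0. \<forall>y\<in>V. norm (y - z) < d \<longrightarrow>
      norm (f y - f z - (\<Sum>b\<in>S. ((y - z) \<bullet> b) *\<^sub>R dir_deriv b f z)) \<le> e * norm (y - z)" if e: "e > 0" for e
  proof -
    obtain d where d: "d > 0" "\<And>w. w \<in> V \<Longrightarrow> norm w < d \<Longrightarrow>
       norm (f (z + w) - f z - (\<Sum>b\<in>S. (w \<bullet> b) *\<^sub>R dir_deriv b f z)) \<le> e * norm w"
      using ck_on_1_linear_approximation[OF assms(1-4) S(1,2,4,5) e] S(3) by blast
    have "norm (f y - f z - (\<Sum>b\<in>S. ((y - z) \<bullet> b) *\<^sub>R dir_deriv b f z)) \<le> e * norm (y - z)"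
      if "y \<in> V" "norm (y - z) < d" for y
      using d(2)[of "y - z"] that zV assms(1) by (simp add: subspace_diff)
    then show ?thesis using d(1) by blast
  qed
  moreover have "bounded_linear (\<lambda>w. \<Sum>b\<in>S. (w \<bullet> b) *\<^sub>R dir_deriv b f z)"
    unfolding linear_conv_bounded_linear[symmetric]
    by (rule linearI) (simp_all add: inner_add_left scaleR_add_left sum.distrib scaleR_sum_right)
  ultimately show ?thesis
    unfolding has_derivative_within_alt by blast
qed

text \<open>
  The values of the curve \<open>\<gamma>\<close> are in \<open>V\<close> near \<open>0\<close> only, so the derivative of \<open>f\<close> within \<open>V\<close> is composed with
  the restriction of \<open>\<gamma>\<close> to a neighbourhood of \<open>0\<close>.
\<close>

lemma has_vector_derivative_compose_within:
  fixes f :: "'e::real_normed_vector \<Rightarrow> 'f::real_normed_vector"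
  assumes "(f has_derivative L) (at (\<gamma> 0) within V)" "(\<gamma> has_vector_derivative w) (at 0)"
    and "\<forall>\<^sub>F t in nhds (0::real). \<gamma> t \<in> V"
  shows "((\<lambda>t. f (\<gamma> t)) has_vector_derivative L w) (at 0)"
proof -
  obtain I where I: "open I" "0 \<in> I" "\<And>t. t \<in> I \<Longrightarrow> \<gamma> t \<in> V"
    using assms(3) by (auto simp: eventually_nhds)
  have "((f \<circ> \<gamma>) has_vector_derivative L w) (at 0 within I)"
  proof (rule vector_derivative_diff_chain_within)
    show "(\<gamma> has_vector_derivative w) (at 0 within I)" using assms(2) by (rule has_vector_derivative_at_within)
    show "(f has_derivative L) (at (\<gamma> 0) within \<gamma> ` I)"
      using assms(1) by (rule has_derivative_subset) (use I(3) in auto)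
  qed
  then show ?thesis
    using at_within_open[OF I(2,1)] by (simp add: o_def)
qed

lemma has_vector_derivative_iff_quotient:
  "(f has_vector_derivative D) (at x) \<longleftrightarrow> ((\<lambda>h. (f (x + h) - f x) /\<^sub>R h) \<longlongrightarrow> D) (at 0)"
proof -
  have "norm (f (x + h) - f x - h *\<^sub>R D) / norm h = norm ((f (x + h) - f x) /\<^sub>R h - D)" if "h \<noteq> 0" for h
  proof -
    have "(f (x + h) - f x) /\<^sub>R h - D = (f (x + h) - f x - h *\<^sub>R D) /\<^sub>R h"
      using that by (simp add: scaleR_diff_right)
    then show ?thesis by (simp add: divide_inverse)
  qed
  then have "((\<lambda>h. norm (f (x + h) - f x - h *\<^sub>R D) / norm h) \<longlongrightarrow> 0) (at 0) \<longleftrightarrow>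
      ((\<lambda>h. norm ((f (x + h) - f x) /\<^sub>R h - D)) \<longlongrightarrow> 0) (at 0)"
    by (intro filterlim_cong) (auto simp: eventually_at_filter)
  then show ?thesis
    by (simp add: has_vector_derivative_def has_derivative_at bounded_linear_scaleR_left tendsto_norm_zero_iff LIM_zero_iff)
qed

lemma has_vector_derivative_in_subspace:
  fixes \<gamma> :: "real \<Rightarrow> 'e::euclidean_space"
  assumes "subspace V" "(\<gamma> has_vector_derivative w) (at 0)" "\<forall>\<^sub>F t in nhds 0. \<gamma> t \<in> V"
  shows "w \<in> V"
proof -
  have lim: "((\<lambda>h. (\<gamma> (0 + h) - \<gamma> 0) /\<^sub>R h) \<longlongrightarrow> w) (at 0)"
    using assms(2) unfolding has_vector_derivative_iff_quotient .
  have 0: "\<gamma> 0 \<in> V" using assms(3) eventually_nhds_x_imp_x by fastforce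
  have "\<forall>\<^sub>F h in at (0::real). (\<gamma> (0 + h) - \<gamma> 0) /\<^sub>R h \<in> V"
    using filter_leD[OF at_within_le_nhds assms(3)]
    by eventually_elim (simp add: 0 assms(1) subspace_scale subspace_diff)
  then show ?thesis
    by (rule Lim_in_closed_set[OF closed_subspace[OF assms(1)] _ _ lim]) simp
qed

lemma dir_deriv_eq_sum:
  fixes f :: "'e::euclidean_space \<Rightarrow> 'f::real_normed_vector"
  assumes "subspace V" "openin (top_of_set V) U" "z \<in> U" "ck_on V 1 U f" "orthonormal_basis_of V S" "w \<in> V"
  shows "dir_deriv w f z = (\<Sum>b\<in>S. (w \<bullet> b) *\<^sub>R dir_deriv b f z)"
proof (rule dir_deriv_eqI)
  have "((\<lambda>t. t *\<^sub>R w) has_vector_derivative w) (at 0)"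
    by (simp add: has_vector_derivative_def bounded_linear_imp_has_derivative bounded_linear_scaleR_left)
  then have "((\<lambda>t. z + t *\<^sub>R w) has_vector_derivative w) (at 0)"
    using has_vector_derivative_add[OF has_vector_derivative_const[of z]] by fastforce
  moreover have "\<forall>\<^sub>F t in nhds (0::real). z + t *\<^sub>R w \<in> V"
    using eventually_line_in[OF assms(1,2,3,6)]
    by eventually_elim (use openin_imp_subset[OF assms(2)] in blast)
  moreover have "(f has_derivative (\<lambda>w. \<Sum>b\<in>S. (w \<bullet> b) *\<^sub>R dir_deriv b f z)) (at (z + 0 *\<^sub>R w) within V)"
    using ck_on_1_has_derivative_within[OF assms(1-5)] by simp
  ultimately show "((\<lambda>t. f (z + t *\<^sub>R w)) has_vector_derivative (\<Sum>b\<in>S. (w \<bullet> b) *\<^sub>R dir_deriv b f z)) (at 0)"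
    using has_vector_derivative_compose_within[of f _ "\<lambda>t. z + t *\<^sub>R w" V w] by blast
qed

text \<open>
  The derivative of \<open>\<phi>\<close> in a direction is a limit of vectors of the closed set \<open>V\<close>, hence itself a direction in
  which \<open>f\<close> may be differentiated.
\<close>

lemma dir_deriv_compose:
  fixes f :: "'e::euclidean_space \<Rightarrow> 'f::real_normed_vector"
    and \<phi> :: "'d::euclidean_space \<Rightarrow> 'e"
  assumes "subspace V" "openin (top_of_set V) U" "ck_on V 1 U f"
    and "subspace V'" "openin (top_of_set V') U'" "ck_on V' 1 U' \<phi>" "\<phi> ` U' \<subseteq> U"
    and "x \<in> U'" "v \<in> V'"
  shows "dir_deriv v \<phi> x \<in> V"
    and "((\<lambda>t. f (\<phi> (x + t *\<^sub>R v))) has_vector_derivative dir_deriv (dir_deriv v \<phi> x) f (\<phi> x)) (at 0)"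
proof -
  have der: "((\<lambda>t. \<phi> (x + t *\<^sub>R v)) has_vector_derivative dir_deriv v \<phi> x) (at 0)"
    using assms by (intro has_vector_derivative_dir_deriv) simp
  have ev: "\<forall>\<^sub>F t in nhds (0::real). \<phi> (x + t *\<^sub>R v) \<in> V"
    using eventually_line_in[OF assms(4,5,8,9)]
    by eventually_elim (use openin_imp_subset[OF assms(2)] assms(7) in blast)
  show w: "dir_deriv v \<phi> x \<in> V"
    using has_vector_derivative_in_subspace[OF assms(1) der ev] .
  obtain S where S: "orthonormal_basis_of V S" using orthonormal_basis_exists[OF assms(1)] .
  have z: "\<phi> x \<in> U" using assms(7,8) by auto
  have "(f has_derivative (\<lambda>w. \<Sum>b\<in>S. (w \<bullet> b) *\<^sub>R dir_deriv b f (\<phi> x))) (at (\<phi> (x + 0 *\<^sub>R v)) within V)"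
    using ck_on_1_has_derivative_within[OF assms(1,2) z assms(3) S] by simp
  then show "((\<lambda>t. f (\<phi> (x + t *\<^sub>R v))) has_vector_derivative dir_deriv (dir_deriv v \<phi> x) f (\<phi> x)) (at 0)"
    unfolding dir_deriv_eq_sum[OF assms(1,2) z assms(3) S w]
    using has_vector_derivative_compose_within[OF _ der ev] by blast
qed

text \<open>
  In a basis of \<open>V\<close> the chain rule is a finite sum of products of functions of the lower order.
\<close>

lemma ck_on_compose:
  fixes f :: "'e::euclidean_space \<Rightarrow> 'f::real_normed_vector"
    and \<phi> :: "'d::euclidean_space \<Rightarrow> 'e"
  assumes "subspace V" "openin (top_of_set V) U" "subspace V'" "openin (top_of_set V') U'"
    and "ck_on V k U f" "ck_on V' k U' \<phi>" "\<phi> ` U' \<subseteq> U"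
  shows "ck_on V' k U' (\<lambda>x. f (\<phi> x))"
  using assms(5,6)
proof (induction k arbitrary: f)
  case 0
  then show ?case using continuous_on_compose2[of U f U' \<phi>] assms(7) by simp
next
  case (Suc k)
  have le: "ck_on V k U f" "ck_on V' k U' \<phi>" "ck_on V 1 U f" "ck_on V' 1 U' \<phi>"
    by (rule ck_on_le[OF Suc.prems(1)] ck_on_le[OF Suc.prems(2)], simp)+
  obtain S where S: "orthonormal_basis_of V S" using orthonormal_basis_exists[OF assms(1)] .
  have der: "((\<lambda>t. f (\<phi> (x + t *\<^sub>R v))) has_vector_derivative
       (\<Sum>b\<in>S. (dir_deriv v \<phi> x \<bullet> b) *\<^sub>R dir_deriv b f (\<phi> x))) (at 0)" if "v \<in> V'" "x \<in> U'" for v x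
  proof -
    note c = dir_deriv_compose[OF assms(1,2) le(3) assms(3,4) le(4) assms(7) that(2,1)]
    have "\<phi> x \<in> U" using assms(7) that by auto
    then show ?thesis
      using c(2) unfolding dir_deriv_eq_sum[OF assms(1,2) \<open>\<phi> x \<in> U\<close> le(3) S c(1)] by blast
  qed
  show ?case
  proof (rule ck_on_SucI[OF assms(3,4) _ der])
    show "continuous_on U' (\<lambda>x. f (\<phi> x))"
      using continuous_on_compose2[OF ck_on_imp_continuous_on[OF le(1)] ck_on_imp_continuous_on[OF le(2)] assms(7)] .
    show "ck_on V' k U' (\<lambda>x. \<Sum>b\<in>S. (dir_deriv v \<phi> x \<bullet> b) *\<^sub>R dir_deriv b f (\<phi> x))" if v: "v \<in> V'" for v
    proof (intro ck_on_sum[OF assms(3,4)] bounded_bilinear.ck_on_prod[OF bounded_bilinear_scaleR assms(3,4)]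
        bounded_bilinear.ck_on_prod[OF bounded_bilinear_inner assms(3,4)] ck_on_const)
      show "ck_on V' k U' (dir_deriv v \<phi>)" using ck_on_SucD(1)[OF Suc.prems(2) v] .
      fix b assume "b \<in> S"
      then have "b \<in> V" using S by (auto simp: orthonormal_basis_of_def)
      then show "ck_on V' k U' (\<lambda>x. dir_deriv b f (\<phi> x))"
        using Suc.IH[OF ck_on_SucD(1)[OF Suc.prems(1)] le(2)] by simp
    qed
  qed auto
qed

section \<open>Gradients with respect to a family of independent vector fields\<close>

text \<open>
  Smooth dependence of the solution of a linear system, by the Gram-Schmidt process: to add the vector
  field \<open>J c\<close>, solve with right-hand side \<open>J c \<bullet> J b\<close> to get the orthogonal projection of \<open>J c\<close> to the
  span of the others, and correct the old solution along the difference.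
\<close>

lemma ck_solution_in_span:
  fixes J :: "'i \<Rightarrow> 'e::real_normed_vector \<Rightarrow> 'f::euclidean_space" and r :: "'i \<Rightarrow> 'e \<Rightarrow> real"
  assumes "subspace V" "openin (top_of_set V) U" "finite S"
    and "\<And>b. b \<in> S \<Longrightarrow> ck_on V k U (J b)" "\<And>b. b \<in> S \<Longrightarrow> ck_on V k U (r b)"
    and "\<And>y. y \<in> U \<Longrightarrow> inj_on (\<lambda>b. J b y) S \<and> independent ((\<lambda>b. J b y) ` S)"
  shows "\<exists>a. ck_on V k U a \<and> (\<forall>y\<in>U. a y \<in> span ((\<lambda>b. J b y) ` S) \<and> (\<forall>b\<in>S. a y \<bullet> J b y = r b y))"
  using assms(3-)
proof (induction S arbitrary: r rule: finite_induct)
  case empty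
  show ?case by (intro exI[of _ "\<lambda>_. 0"]) (simp add: ck_on_const)
next
  case (insert c S)
  have Jc: "ck_on V k U (J c)" and rc: "ck_on V k U (r c)" using insert.prems by auto
  have ind: "inj_on (\<lambda>b. J b y) S \<and> independent ((\<lambda>b. J b y) ` S) \<and> J c y \<notin> span ((\<lambda>b. J b y) ` S)"
    if "y \<in> U" for y
  proof -
    have "J c y \<notin> (\<lambda>b. J b y) ` S" "inj_on (\<lambda>b. J b y) S"
      using insert.prems(3)[OF that] insert.hyps(2) by auto
    then show ?thesis
      using insert.prems(3)[OF that] by (simp add: independent_insert)
  qed
  have IH: "\<exists>a. ck_on V k U a \<and> (\<forall>y\<in>U. a y \<in> span ((\<lambda>b. J b y) ` S) \<and> (\<forall>b\<in>S. a y \<bullet> J b y = s b y))"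
    if "\<And>b. b \<in> S \<Longrightarrow> ck_on V k U (s b)" for s
    by (rule insert.IH) (use insert.prems(1) that ind in blast)+
  obtain a where a: "ck_on V k U a" "\<And>y. y \<in> U \<Longrightarrow> a y \<in> span ((\<lambda>b. J b y) ` S)"
    "\<And>y b. y \<in> U \<Longrightarrow> b \<in> S \<Longrightarrow> a y \<bullet> J b y = r b y"
    using IH[of r] insert.prems(2) by blast
  have "ck_on V k U (\<lambda>y. J c y \<bullet> J b y)" if "b \<in> S" for b
    using insert.prems(1) that by (intro bounded_bilinear.ck_on_prod[OF bounded_bilinear_inner assms(1,2)]) auto
  then obtain p where p: "ck_on V k U p" "\<And>y. y \<in> U \<Longrightarrow> p y \<in> span ((\<lambda>b. J b y) ` S)"
    "\<And>y b. y \<in> U \<Longrightarrow> b \<in> S \<Longrightarrow> p y \<bullet> J b y = J c y \<bullet> J b y"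
    using IH[of "\<lambda>b y. J c y \<bullet> J b y"] by blast
  define n where "n y = J c y + - p y" for y
  have n: "ck_on V k U n"
    unfolding n_def by (intro ck_on_add[OF assms(1,2)] ck_on_minus[OF assms(1,2)] Jc p)
  have n_orth: "n y \<bullet> u = 0" if "y \<in> U" "u \<in> span ((\<lambda>b. J b y) ` S)" for y u
    using that(2)
  proof (induction rule: span_induct_alt)
    case (step c' v u)
    then obtain b where "b \<in> S" "v = J b y" by blast
    then have "n y \<bullet> v = 0" using p(3)[OF that(1)] by (simp add: n_def inner_diff_left)
    then show ?case using step by (simp add: inner_add_right)
  qed simp
  have nJc: "n y \<bullet> J c y = n y \<bullet> n y" if "y \<in> U" for y
    using n_orth[OF that p(2)[OF that]] by (simp add: n_def inner_diff_right)
  have n0: "n y \<bullet> J c y \<noteq> 0" if "y \<in> U" for y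
    unfolding nJc[OF that] using ind[OF that] p(2)[OF that] by (auto simp: n_def)
  define \<kappa> where "\<kappa> y = (r c y + - (a y \<bullet> J c y)) * inverse (n y \<bullet> J c y)" for y
  have inner_ck: "ck_on V k U (\<lambda>y. f y \<bullet> g y)" if "ck_on V k U f" "ck_on V k U g" for f g :: "'e \<Rightarrow> 'f"
    using that by (rule bounded_bilinear.ck_on_prod[OF bounded_bilinear_inner assms(1,2)])
  have \<kappa>: "ck_on V k U \<kappa>"
    unfolding \<kappa>_def
    by (intro bounded_bilinear.ck_on_prod[OF bounded_bilinear_mult assms(1,2)] ck_on_inverse[OF assms(1,2)]
        ck_on_add[OF assms(1,2)] ck_on_minus[OF assms(1,2)] inner_ck rc a(1) Jc n n0)
  show ?case
  proof (intro exI[of _ "\<lambda>y. a y + \<kappa> y *\<^sub>R n y"] conjI ballI)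
    show "ck_on V k U (\<lambda>y. a y + \<kappa> y *\<^sub>R n y)"
      by (intro ck_on_add[OF assms(1,2)] bounded_bilinear.ck_on_prod[OF bounded_bilinear_scaleR assms(1,2)] a(1) \<kappa> n)
  next
    fix y assume y: "y \<in> U"
    have sub: "span ((\<lambda>b. J b y) ` S) \<subseteq> span ((\<lambda>b. J b y) ` insert c S)" by (intro span_mono) auto
    have "J c y \<in> span ((\<lambda>b. J b y) ` insert c S)" by (intro span_base) auto
    then have "n y \<in> span ((\<lambda>b. J b y) ` insert c S)"
      using sub p(2)[OF y] by (auto simp: n_def intro!: span_diff)
    then show "a y + \<kappa> y *\<^sub>R n y \<in> span ((\<lambda>b. J b y) ` insert c S)"
      using sub a(2)[OF y] by (intro span_add span_scale) auto
    fix b assume "b \<in> insert c S"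
    then consider "b = c" | "b \<in> S" by auto
    then show "(a y + \<kappa> y *\<^sub>R n y) \<bullet> J b y = r b y"
    proof cases
      case 1
      then show ?thesis using n0[OF y] by (simp add: inner_add_left \<kappa>_def mult.assoc)
    next
      case 2
      then have "n y \<bullet> J b y = 0" by (intro n_orth[OF y] span_base) auto
      then show ?thesis using a(3)[OF y 2] by (simp add: inner_add_left)
    qed
  qed
qed

section \<open>Functions read in charts\<close>

lemma chart_inj_on: "is_chart V c \<Longrightarrow> inj_on (snd c) (fst c)"
  using homeomorphic_imp_injective_map[of "top_of_set (fst c)" "top_of_set (chart_image c)" "snd c"]
  by (simp add: is_chart_def)

lemma local_rep_chart_apply [simp]:
  assumes "is_chart V c" "p \<in> fst c"
  shows "local_rep c f (snd c p) = f p"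
  using chart_inj_on[OF assms(1)] assms(2) by (simp add: local_rep_def)

lemma chart_openin:
  assumes "is_chart V c" "open W"
  shows "openin (top_of_set V) (snd c ` (fst c \<inter> W))"
proof -
  have "openin (top_of_set (chart_image c)) (snd c ` (fst c \<inter> W))"
    using assms homeomorphic_imp_open_map[of "top_of_set (fst c)" "top_of_set (chart_image c)" "snd c"]
    by (simp add: is_chart_def open_map_def openin_open_Int)
  moreover have "openin (top_of_set V) (chart_image c)"
    using assms(1) by (simp add: is_chart_def)
  ultimately show ?thesis by (rule openin_trans)
qed

lemma chart_image_openin: "is_chart V c \<Longrightarrow> openin (top_of_set V) (chart_image c)"
  by (simp add: is_chart_def)

lemma continuous_on_local_rep_iff:
  assumes "is_chart V c"
  shows "continuous_on (chart_image c) (local_rep c f) \<longleftrightarrow> continuous_on (fst c) f"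
proof
  obtain g where "homeomorphic_maps (top_of_set (fst c)) (top_of_set (chart_image c)) (snd c) g"
    using assms by (auto simp: is_chart_def homeomorphic_map_maps)
  then have g: "continuous_on (fst c) (snd c)" "continuous_on (chart_image c) g" "g ` chart_image c \<subseteq> fst c"
    "\<And>p. p \<in> fst c \<Longrightarrow> g (snd c p) = p"
    by (auto simp: homeomorphic_maps_def)
  {
    assume "continuous_on (chart_image c) (local_rep c f)"
    then have "continuous_on (fst c) (\<lambda>p. local_rep c f (snd c p))"
      by (rule continuous_on_compose2[OF _ g(1)]) (simp add: chart_image_def)
    then show "continuous_on (fst c) f"
      by (rule continuous_on_eq) (simp add: local_rep_chart_apply[OF assms])
  next
    assume "continuous_on (fst c) f"
    then have "continuous_on (chart_image c) (\<lambda>y. f (g y))"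
      by (rule continuous_on_compose2[OF _ g(2,3)])
    then show "continuous_on (chart_image c) (local_rep c f)"
    proof (rule continuous_on_eq)
      fix y assume "y \<in> chart_image c"
      then obtain p where "p \<in> fst c" "y = snd c p" by (auto simp: chart_image_def)
      then show "f (g y) = local_rep c f y" using assms g(4) by simp
    qed
  }
qed

lemma ck_function_le: "ck_function k V A f \<Longrightarrow> m \<le> k \<Longrightarrow> ck_function m V A f"
  unfolding ck_function_def using ck_on_le by blast

lemma continuous_on_if_ck_function:
  fixes f :: "'m::t2_space \<Rightarrow> 'f::real_normed_vector"
  assumes "\<And>c. c \<in> A \<Longrightarrow> is_chart V c" "(\<Union>c\<in>A. fst c) = UNIV" "ck_function k V A f"
  shows "continuous_on UNIV f"
proof -
  have "isCont f p" for p
  proof -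
    obtain c where c: "c \<in> A" "p \<in> fst c" using assms(2) by blast
    have "continuous_on (chart_image c) (local_rep c f)"
      using assms(3) c(1) ck_on_imp_continuous_on unfolding ck_function_def by blast
    then have "continuous_on (fst c) f" by (rule iffD1[OF continuous_on_local_rep_iff[OF assms(1)[OF c(1)]]])
    moreover have "open (fst c)" using assms(1)[OF c(1)] by (simp add: is_chart_def)
    ultimately show ?thesis using c(2) by (simp add: continuous_on_eq_continuous_at)
  qed
  then show ?thesis by (simp add: continuous_on_eq_continuous_at)
qed

text \<open>
  One map \<open>T\<close> read in one chart of the source and one of the target. Changes of charts are the case of
  the identity map.
\<close>

locale ck_map_in_charts =
  fixes k :: nat and V :: "'d::euclidean_space set" and V' :: "'e::euclidean_space set"
    and c :: "('x::topological_space, 'd) chart" and d :: "('m::topological_space, 'e) chart"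
    and T :: "'x \<Rightarrow> 'm"
  assumes subspaces: "subspace V" "subspace V'"
    and charts: "is_chart V c" "is_chart V' d"
    and continuous: "continuous_on UNIV T"
    and ck: "ck_on V k (snd c ` (fst c \<inter> T -` fst d)) (local_rep c (snd d \<circ> T))"
begin

lemma overlap_openin: "openin (top_of_set V) (snd c ` (fst c \<inter> T -` fst d))"
proof (rule chart_openin[OF charts(1)])
  have "open (fst d)" using charts(2) by (simp add: is_chart_def)
  then show "open (T -` fst d)" using continuous by (simp add: open_vimage)
qed

lemma local_rep_compose:
  assumes "y \<in> snd c ` (fst c \<inter> T -` fst d)"
  shows "local_rep d f (local_rep c (snd d \<circ> T) y) = local_rep c (f \<circ> T) y"
  using assms charts by auto

lemma overlap_maps_to: "local_rep c (snd d \<circ> T) ` (snd c ` (fst c \<inter> T -` fst d)) \<subseteq> chart_image d"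
  using charts by (auto simp: chart_image_def)

lemma ck_on_local_rep_compose:
  assumes "ck_on V' k (chart_image d) (local_rep d f)"
  shows "ck_on V k (snd c ` (fst c \<inter> T -` fst d)) (local_rep c (f \<circ> T))"
  by (rule ck_on_cong[OF subspaces(1) overlap_openin local_rep_compose
        ck_on_compose[OF subspaces(2) chart_image_openin[OF charts(2)] subspaces(1) overlap_openin assms ck overlap_maps_to]])

lemma dir_deriv_local_rep_compose:
  assumes "1 \<le> k" "ck_on V' 1 (chart_image d) (local_rep d f)"
    and "p \<in> fst c" "T p \<in> fst d" "v \<in> V"
  defines "w \<equiv> dir_deriv v (local_rep c (snd d \<circ> T)) (snd c p)"
  shows "w \<in> V'"
    and "((\<lambda>t. local_rep c (f \<circ> T) (snd c p + t *\<^sub>R v)) has_vector_derivative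
           dir_deriv w (local_rep d f) (snd d (T p))) (at 0)"
    and "dir_deriv v (local_rep c (f \<circ> T)) (snd c p) = dir_deriv w (local_rep d f) (snd d (T p))"
proof -
  have y: "snd c p \<in> snd c ` (fst c \<inter> T -` fst d)" using assms by auto
  note D = dir_deriv_compose[OF subspaces(2) chart_image_openin[OF charts(2)] assms(2) subspaces(1)
      overlap_openin ck_on_le[OF ck assms(1)] overlap_maps_to y assms(5)]
  show "w \<in> V'" unfolding w_def by (rule D(1))
  have "local_rep c (snd d \<circ> T) (snd c p) = snd d (T p)" using assms charts by simp
  then show H: "((\<lambda>t. local_rep c (f \<circ> T) (snd c p + t *\<^sub>R v)) has_vector_derivative
           dir_deriv w (local_rep d f) (snd d (T p))) (at 0)"
    using has_vector_derivative_cong_line[OF subspaces(1) overlap_openin y assms(5) local_rep_compose D(2)]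
    unfolding w_def by simp
  then show "dir_deriv v (local_rep c (f \<circ> T)) (snd c p) = dir_deriv w (local_rep d f) (snd d (T p))"
    by (rule dir_deriv_eqI)
qed

end

lemma ck_structureD:
  assumes "ck_structure k V A"
  shows "subspace V" "c \<in> A \<Longrightarrow> is_chart V c" "(\<Union>c\<in>A. fst c) = UNIV"
    "c \<in> A \<Longrightarrow> d \<in> A \<Longrightarrow> compatible_charts k V c d"
  using assms unfolding ck_structure_def by blast+

lemma ck_map_in_charts_id:
  assumes "ck_structure k V A" "c \<in> A" "d \<in> A"
  shows "ck_map_in_charts k V V c d (\<lambda>x. x)"
proof
  have "compatible_charts k V c d" using assms ck_structureD(4) by blast
  then show "ck_on V k (snd c ` (fst c \<inter> (\<lambda>x. x) -` fst d)) (local_rep c (snd d \<circ> (\<lambda>x. x)))"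
    by (simp add: compatible_charts_def o_def vimage_def Int_def)
qed (use ck_structureD[OF assms(1)] assms(2,3) in auto)

lemma ck_map_in_charts_if_ck_map:
  assumes "ck_structure k V A" "ck_structure k' V' A'" "ck_map k V A A' T" "c \<in> A" "d \<in> A'"
  shows "ck_map_in_charts k V V' c d T"
  using ck_structureD[OF assms(1)] ck_structureD[OF assms(2)] assms(3-5)
  by unfold_locales (auto simp: ck_map_def)

section \<open>The gradient with respect to the embedding\<close>

text \<open>
  The vector \<open>\<alpha>\<close> is the image under \<open>d\<iota>\<close> of the Riemannian gradient of \<open>h\<close> for the metric induced by \<open>\<iota>\<close>. Being tangent to the image of
  \<open>\<iota>\<close> makes it unique.
\<close>

definition tangent_gradient_at ::
    "'e::euclidean_space set \<Rightarrow> ('m::topological_space \<Rightarrow> 'f::euclidean_space) \<Rightarrow> ('m \<Rightarrow> real) \<Rightarrow> ('m, 'e) chart \<Rightarrow> 'm \<Rightarrow> 'f \<Rightarrow> bool" where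
  "tangent_gradient_at V \<iota> h c p \<alpha> \<longleftrightarrow> \<alpha> \<in> (\<lambda>v. dir_deriv v (local_rep c \<iota>) (snd c p)) ` V \<and>
     (\<forall>v\<in>V. dir_deriv v (local_rep c h) (snd c p) = \<alpha> \<bullet> dir_deriv v (local_rep c \<iota>) (snd c p))"

text \<open>
  Two candidates have the same products with every vector in the range of \<open>d\<iota>\<close>, in particular with each other
  and with themselves.
\<close>

lemma tangent_gradient_at_unique:
  assumes "tangent_gradient_at V \<iota> h c p \<alpha>" "tangent_gradient_at V \<iota> h c p \<beta>"
  shows "\<alpha> = \<beta>"
proof -
  obtain u where u: "u \<in> V" "\<alpha> = dir_deriv u (local_rep c \<iota>) (snd c p)"
    using assms(1) by (auto simp: tangent_gradient_at_def)
  obtain w where w: "w \<in> V" "\<beta> = dir_deriv w (local_rep c \<iota>) (snd c p)"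
    using assms(2) by (auto simp: tangent_gradient_at_def)
  have "\<alpha> \<bullet> \<alpha> = \<beta> \<bullet> \<alpha>" "\<alpha> \<bullet> \<beta> = \<beta> \<bullet> \<beta>"
    using assms u w unfolding tangent_gradient_at_def by metis+
  then have "(\<alpha> - \<beta>) \<bullet> (\<alpha> - \<beta>) = 0" by (simp add: inner_diff_left inner_diff_right inner_commute)
  then show ?thesis by simp
qed

text \<open>
  The differential of the change of charts carries the derivatives of \<open>h\<close> and of \<open>\<iota>\<close> in one chart to those in the
  other; used in one direction it preserves the equation, in the other direction the range.
\<close>

lemma tangent_gradient_at_change_chart:
  fixes h :: "'m::{t2_space, second_countable_topology} \<Rightarrow> real"
  assumes "ck_structure k V A" "1 \<le> k" "ck_function 1 V A \<iota>" "ck_function 1 V A h"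
    and "c \<in> A" "d \<in> A" "p \<in> fst c" "p \<in> fst d"
    and "tangent_gradient_at V \<iota> h c p \<alpha>"
  shows "tangent_gradient_at V \<iota> h d p \<alpha>"
proof -
  interpret cd: ck_map_in_charts k V V c d "\<lambda>x. x" using ck_map_in_charts_id assms(1,5,6) .
  interpret dc: ck_map_in_charts k V V d c "\<lambda>x. x" using ck_map_in_charts_id assms(1,6,5) .
  have rep: "ck_on V 1 (chart_image b) (local_rep b \<iota>)" "ck_on V 1 (chart_image b) (local_rep b h)" if "b \<in> A" for b
    using assms(3,4) that unfolding ck_function_def by blast+
  note cd = cd.dir_deriv_local_rep_compose[OF assms(2) _ assms(7,8), unfolded o_def]
  note dc = dc.dir_deriv_local_rep_compose[OF assms(2) _ assms(8,7), unfolded o_def]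
  obtain u where u: "u \<in> V" "\<alpha> = dir_deriv u (local_rep c \<iota>) (snd c p)"
    using assms(9) by (auto simp: tangent_gradient_at_def)
  have "\<alpha> \<in> (\<lambda>v. dir_deriv v (local_rep d \<iota>) (snd d p)) ` V"
    unfolding u(2) cd(3)[OF rep(1)[OF assms(6)] u(1)] using cd(1)[OF rep(1)[OF assms(6)] u(1)] by (rule imageI)
  moreover have "dir_deriv v (local_rep d h) (snd d p) = \<alpha> \<bullet> dir_deriv v (local_rep d \<iota>) (snd d p)"
    if v: "v \<in> V" for v
    unfolding dc(3)[OF rep(1)[OF assms(5)] v] dc(3)[OF rep(2)[OF assms(5)] v]
    using assms(9) dc(1)[OF rep(1)[OF assms(5)] v] unfolding tangent_gradient_at_def by blast
  ultimately show ?thesis by (simp add: tangent_gradient_at_def)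
qed

text \<open>
  It suffices to prescribe the products with the derivatives of \<open>\<iota>\<close> along a basis of \<open>V\<close>; these are linearly
  independent because \<open>d\<iota>\<close> is injective.
\<close>

lemma tangent_gradient_in_chart:
  fixes h :: "'m::topological_space \<Rightarrow> real" and \<iota> :: "'m \<Rightarrow> 'f::euclidean_space"
    and c :: "('m, 'e::euclidean_space) chart"
  assumes "subspace V" "is_chart V c"
    and "ck_on V (Suc j) (chart_image c) (local_rep c \<iota>)" "ck_on V (Suc j) (chart_image c) (local_rep c h)"
    and "\<And>p. p \<in> fst c \<Longrightarrow> inj_on (\<lambda>v. dir_deriv v (local_rep c \<iota>) (snd c p)) V"
  shows "\<exists>a. ck_on V j (chart_image c) a \<and> (\<forall>p\<in>fst c. tangent_gradient_at V \<iota> h c p (a (snd c p)))"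
proof -
  let ?I = "local_rep c \<iota>" and ?h = "local_rep c h"
  obtain S where S: "orthonormal_basis_of V S" using orthonormal_basis_exists[OF assms(1)] .
  then have S': "finite S" "S \<subseteq> V" "span S = V" "independent S" by (simp_all add: orthonormal_basis_of_def)
  note op = chart_image_openin[OF assms(2)]
  have c1: "ck_on V 1 (chart_image c) ?I" "ck_on V 1 (chart_image c) ?h"
    by (rule ck_on_le[OF assms(3)] ck_on_le[OF assms(4)], simp)+
  define L where "L y w = (\<Sum>b\<in>S. (w \<bullet> b) *\<^sub>R dir_deriv b ?I y)" for y w
  have lin: "linear (L y)" for y
    unfolding L_def by (rule linearI) (simp_all add: inner_add_left scaleR_add_left sum.distrib scaleR_sum_right)
  have L: "dir_deriv v ?I y = L y v" if "y \<in> chart_image c" "v \<in> V" for y v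
    unfolding L_def by (rule dir_deriv_eq_sum[OF assms(1) op that(1) c1(1) S that(2)])
  have inj: "inj_on (L y) V" if y: "y \<in> chart_image c" for y
  proof -
    obtain p where "p \<in> fst c" "y = snd c p" using y by (auto simp: chart_image_def)
    then have "inj_on (\<lambda>v. dir_deriv v ?I y) V" using assms(5) by simp
    then show ?thesis using inj_on_cong[of V "\<lambda>v. dir_deriv v ?I y" "L y"] L[OF y] by simp
  qed
  have im: "(\<lambda>b. dir_deriv b ?I y) ` S = L y ` S" if "y \<in> chart_image c" for y
    using L[OF that] S'(2) by (intro image_cong) auto
  have ind: "inj_on (\<lambda>b. dir_deriv b ?I y) S \<and> independent ((\<lambda>b. dir_deriv b ?I y) ` S)"
    if y: "y \<in> chart_image c" for y
  proof
    have "inj_on (L y) S" using inj[OF y] S'(2) by (rule inj_on_subset)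
    then show "inj_on (\<lambda>b. dir_deriv b ?I y) S"
      using inj_on_cong[of S "\<lambda>b. dir_deriv b ?I y" "L y"] L[OF y] S'(2) by blast
    show "independent ((\<lambda>b. dir_deriv b ?I y) ` S)"
      unfolding im[OF y] using lin S'(4) inj[OF y] S'(3) linear_independent_injective_image[of "L y" S] by simp
  qed
  have "ck_on V j (chart_image c) (dir_deriv b ?I)" "ck_on V j (chart_image c) (dir_deriv b ?h)" if "b \<in> S" for b
    using ck_on_SucD(1)[OF assms(3)] ck_on_SucD(1)[OF assms(4)] that S'(2) by blast+
  then obtain a where a: "ck_on V j (chart_image c) a"
    "\<forall>y\<in>chart_image c. a y \<in> span ((\<lambda>b. dir_deriv b ?I y) ` S) \<and> (\<forall>b\<in>S. a y \<bullet> dir_deriv b ?I y = dir_deriv b ?h y)"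
    using ck_solution_in_span[OF assms(1) op S'(1), of j "\<lambda>b. dir_deriv b ?I" "\<lambda>b. dir_deriv b ?h"] ind by blast
  have "tangent_gradient_at V \<iota> h c p (a (snd c p))" if p: "p \<in> fst c" for p
  proof -
    have y: "snd c p \<in> chart_image c" using p by (simp add: chart_image_def)
    have "a (snd c p) \<in> L (snd c p) ` V"
      using bspec[OF a(2) y] unfolding im[OF y] linear_span_image[OF lin] S'(3) by (rule conjunct1)
    then have "a (snd c p) \<in> (\<lambda>v. dir_deriv v ?I (snd c p)) ` V"
      using L[OF y] by (simp cong: image_cong)
    moreover have "dir_deriv v ?h (snd c p) = a (snd c p) \<bullet> dir_deriv v ?I (snd c p)" if v: "v \<in> V" for v
    proof -
      have "dir_deriv v ?h (snd c p) = (\<Sum>b\<in>S. (v \<bullet> b) * (a (snd c p) \<bullet> dir_deriv b ?I (snd c p)))"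
        unfolding dir_deriv_eq_sum[OF assms(1) op y c1(2) S v] using a(2) y by (intro sum.cong) simp_all
      also have "\<dots> = a (snd c p) \<bullet> L (snd c p) v"
        by (simp add: L_def inner_sum_right)
      finally show ?thesis using L[OF y v] by simp
    qed
    ultimately show ?thesis by (simp add: tangent_gradient_at_def)
  qed
  then show ?thesis using a(1) by blast
qed

text \<open>
  The gradients found in the single charts agree by uniqueness, hence are local expressions of one function on the manifold.
\<close>

lemma gradient_of_ck_function:
  fixes h :: "'m::{t2_space, second_countable_topology} \<Rightarrow> real" and \<iota> :: "'m \<Rightarrow> 'f::euclidean_space"
  assumes "ck_structure k V A" "Suc j \<le> k" "ck_embedding k V A \<iota>" "ck_function (Suc j) V A h"
  obtains a where "ck_function j V A a"
    and "\<And>c p v. c \<in> A \<Longrightarrow> p \<in> fst c \<Longrightarrow> v \<in> V \<Longrightarrow>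
       dir_deriv v (local_rep c h) (snd c p) = a p \<bullet> dir_deriv v (local_rep c \<iota>) (snd c p)"
proof -
  note str = ck_structureD[OF assms(1)]
  have \<iota>: "ck_function m V A \<iota>" if "m \<le> k" for m
    using assms(3) ck_function_le[OF _ that] unfolding ck_embedding_def by blast
  have h1: "ck_function 1 V A h"
    by (rule ck_function_le[OF assms(4)]) simp
  have "\<exists>a. ck_on V j (chart_image c) a \<and> (\<forall>p\<in>fst c. tangent_gradient_at V \<iota> h c p (a (snd c p)))"
    if c: "c \<in> A" for c
  proof (rule tangent_gradient_in_chart[OF str(1) str(2)[OF c]])
    show "ck_on V (Suc j) (chart_image c) (local_rep c \<iota>)" "ck_on V (Suc j) (chart_image c) (local_rep c h)"
      using \<iota>[OF assms(2)] assms(4) c unfolding ck_function_def by blast+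
    show "inj_on (\<lambda>v. dir_deriv v (local_rep c \<iota>) (snd c p)) V" if "p \<in> fst c" for p
      using assms(3) c that unfolding ck_embedding_def by blast
  qed
  then obtain g where g: "\<And>c. c \<in> A \<Longrightarrow> ck_on V j (chart_image c) (g c)"
    "\<And>c p. c \<in> A \<Longrightarrow> p \<in> fst c \<Longrightarrow> tangent_gradient_at V \<iota> h c p (g c (snd c p))"
    by metis
  define a where "a p = (SOME \<alpha>. \<exists>c\<in>A. p \<in> fst c \<and> tangent_gradient_at V \<iota> h c p \<alpha>)" for p
  have grad: "tangent_gradient_at V \<iota> h c p (a p)" if c: "c \<in> A" "p \<in> fst c" for c p
  proof -
    have "\<exists>\<alpha>. \<exists>c\<in>A. p \<in> fst c \<and> tangent_gradient_at V \<iota> h c p \<alpha>" using g(2)[OF c] c by blast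
    then have "\<exists>c\<in>A. p \<in> fst c \<and> tangent_gradient_at V \<iota> h c p (a p)" unfolding a_def by (rule someI_ex)
    then obtain d where d: "d \<in> A" "p \<in> fst d" "tangent_gradient_at V \<iota> h d p (a p)" by blast
    have k: "1 \<le> k" using assms(2) by simp
    show ?thesis
      by (rule tangent_gradient_at_change_chart[OF assms(1) k \<iota>[OF k] h1 d(1) c(1) d(2) c(2) d(3)])
  qed
  have "ck_on V j (chart_image c) (local_rep c a)" if c: "c \<in> A" for c
  proof (rule ck_on_cong[OF str(1) chart_image_openin[OF str(2)[OF c]] _ g(1)[OF c]])
    fix y assume "y \<in> chart_image c"
    then obtain p where p: "p \<in> fst c" "y = snd c p" by (auto simp: chart_image_def)
    show "g c y = local_rep c a y"
      using tangent_gradient_at_unique[OF g(2)[OF c p(1)] grad[OF c p(1)]] p str(2)[OF c] by simp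
  qed
  then have "ck_function j V A a" by (simp add: ck_function_def)
  moreover have "dir_deriv v (local_rep c h) (snd c p) = a p \<bullet> dir_deriv v (local_rep c \<iota>) (snd c p)"
    if "c \<in> A" "p \<in> fst c" "v \<in> V" for c p v
    using grad[OF that(1,2)] that(3) by (simp add: tangent_gradient_at_def)
  ultimately show thesis by (rule that)
qed

section \<open>Uniform bounds for the composed families\<close>

text \<open>
  The seminorm controls unit directions only; a general direction is a multiple of one of these.
\<close>

lemma equibounded_ck_if_unit_bounds:
  fixes F :: "'w \<Rightarrow> 'e::real_normed_vector \<Rightarrow> 'f::real_normed_vector"
  assumes "subspace V" "openin (top_of_set V) U" "\<And>\<omega>. \<omega> \<in> \<Omega> \<Longrightarrow> ck_on V k U (F \<omega>)"
    and "\<And>\<omega> y vs. \<omega> \<in> \<Omega> \<Longrightarrow> y \<in> U \<Longrightarrow> set vs \<subseteq> V \<inter> cball 0 1 \<Longrightarrow> length vs \<le> k \<Longrightarrow>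
           norm (iter_dir_deriv vs (F \<omega>) y) \<le> C"
  shows "equibounded_ck V k U \<Omega> F"
  using assms(3,4)
proof (induction k arbitrary: F)
  case 0
  show ?case
    unfolding equibounded_ck.simps
  proof (rule equibounded_continuousI)
    show "continuous_on U (F \<omega>)" if "\<omega> \<in> \<Omega>" for \<omega> using 0(1)[OF that] by simp
    show "norm (F \<omega> y) \<le> C" if "\<omega> \<in> \<Omega>" "y \<in> U" for \<omega> y
      using 0(2)[of \<omega> y "[]"] that by simp
  qed
next
  case (Suc k)
  have bdd: "equibounded_continuous U \<Omega> F"
  proof (rule equibounded_continuousI)
    show "continuous_on U (F \<omega>)" if "\<omega> \<in> \<Omega>" for \<omega>
      by (rule ck_on_imp_continuous_on[OF Suc.prems(1)[OF that]])
    show "norm (F \<omega> y) \<le> C" if "\<omega> \<in> \<Omega>" "y \<in> U" for \<omega> y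
      using Suc.prems(2)[of \<omega> y "[]"] that by simp
  qed
  \<comment> \<open>For \<open>v = 0\<close> this is \<open>0\<close>, which is good enough.\<close>
  define u where "u v = v /\<^sub>R norm v" for v :: 'e
  have u: "u v \<in> V" "u v \<in> cball 0 1" "v = norm v *\<^sub>R u v" if "v \<in> V" for v
    by (cases "v = 0"; use that assms(1) in \<open>simp add: u_def subspace_scale\<close>)+
  show ?case
  proof (rule equibounded_ck_SucI[OF assms(1,2) bdd])
    fix v \<omega> x assume *: "v \<in> V" "\<omega> \<in> \<Omega>" "x \<in> U"
    have "((\<lambda>t. F \<omega> (x + t *\<^sub>R u v)) has_vector_derivative dir_deriv (u v) (F \<omega>) x) (at (norm v * 0))"
      using ck_on_SucD(2)[OF Suc.prems(1)[OF *(2)] u(1)[OF *(1)] *(3)] by simp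
    moreover have "((\<lambda>t. norm v * t) has_vector_derivative norm v) (at 0)"
      unfolding has_real_derivative_iff_has_vector_derivative[symmetric] by (auto intro!: derivative_eq_intros)
    ultimately have "((\<lambda>t. F \<omega> (x + t *\<^sub>R u v)) \<circ> (\<lambda>t. norm v * t) has_vector_derivative
        norm v *\<^sub>R dir_deriv (u v) (F \<omega>) x) (at 0)"
      by (intro vector_diff_chain_at)
    moreover have "(\<lambda>t. F \<omega> (x + t *\<^sub>R u v)) \<circ> (\<lambda>t. norm v * t) = (\<lambda>t. F \<omega> (x + t *\<^sub>R v))"
    proof
      fix t :: real
      have "(norm v * t) *\<^sub>R u v = t *\<^sub>R (norm v *\<^sub>R u v)" by simp
      then show "((\<lambda>t. F \<omega> (x + t *\<^sub>R u v)) \<circ> (\<lambda>t. norm v * t)) t = F \<omega> (x + t *\<^sub>R v)"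
        using u(3)[OF *(1)] by simp
    qed
    ultimately show "((\<lambda>t. F \<omega> (x + t *\<^sub>R v)) has_vector_derivative norm v *\<^sub>R dir_deriv (u v) (F \<omega>) x) (at 0)"
      by simp
  next
    fix v assume v: "v \<in> V"
    have "equibounded_ck V k U \<Omega> (\<lambda>\<omega>. dir_deriv (u v) (F \<omega>))"
    proof (rule Suc.IH)
      show "ck_on V k U (dir_deriv (u v) (F \<omega>))" if "\<omega> \<in> \<Omega>" for \<omega>
        by (rule ck_on_SucD(1)[OF Suc.prems(1)[OF that] u(1)[OF v]])
      show "norm (iter_dir_deriv vs (dir_deriv (u v) (F \<omega>)) y) \<le> C"
        if "\<omega> \<in> \<Omega>" "y \<in> U" "set vs \<subseteq> V \<inter> cball 0 1" "length vs \<le> k" for \<omega> y vs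
        using Suc.prems(2)[of \<omega> y "u v # vs"] that u(1,2)[OF v] by simp
    qed
    then show "equibounded_ck V k U \<Omega> (\<lambda>\<omega> x. norm v *\<^sub>R dir_deriv (u v) (F \<omega>) x)"
      by (rule bounded_bilinear.equibounded_ck_prod[OF bounded_bilinear_scaleR assms(1,2)
            equibounded_ck_const_family[OF ck_on_const]])
  qed
qed

lemma norm_iter_dir_deriv_le_ck_seminorm:
  assumes "ck_seminorm k V B F \<le> ennreal C" "0 \<le> C"
    and "c \<in> B" "y \<in> chart_image c" "set vs \<subseteq> V \<inter> cball 0 1" "length vs \<in> {1..k}"
  shows "norm (iter_dir_deriv vs (local_rep c F) y) \<le> C"
proof -
  have "ennreal (norm (iter_dir_deriv vs (local_rep c F) y)) \<le> ck_seminorm k V B F"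
    unfolding ck_seminorm_def using assms(3-6) by (intro Sup_upper) blast
  then have "ennreal (norm (iter_dir_deriv vs (local_rep c F) y)) \<le> ennreal C"
    using assms(1) by (rule order_trans)
  then show ?thesis using assms(2) by simp
qed

text \<open>
  A chart of the source need not be mapped into a single chart of the target, but being \<open>C\<^sup>k\<close> is a local property.
\<close>

lemma ck_on_local_rep_composeI:
  fixes f :: "'m::topological_space \<Rightarrow> 'f::real_normed_vector"
    and c :: "('x::topological_space, 'd::euclidean_space) chart"
    and V' :: "'e::euclidean_space set"
  assumes "is_chart V c"
    and "\<And>p. p \<in> fst c \<Longrightarrow> \<exists>d. T p \<in> fst d \<and> ck_map_in_charts k V V' c d T \<and> ck_on V' k (chart_image d) (local_rep d f)"
  shows "ck_on V k (chart_image c) (local_rep c (f \<circ> T))"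
proof (rule ck_on_local)
  show "chart_image c \<subseteq> V" by (rule openin_imp_subset[OF chart_image_openin[OF assms(1)]])
  fix y assume "y \<in> chart_image c"
  then obtain p where p: "p \<in> fst c" "y = snd c p" by (auto simp: chart_image_def)
  obtain d where d: "T p \<in> fst d" "ck_map_in_charts k V V' c d T" "ck_on V' k (chart_image d) (local_rep d f)"
    using assms(2)[OF p(1)] by blast
  interpret ck_map_in_charts k V V' c d T by (rule d(2))
  show "\<exists>W. openin (top_of_set V) W \<and> y \<in> W \<and> ck_on V k W (local_rep c (f \<circ> T))"
    using overlap_openin ck_on_local_rep_compose[OF d(3)] p d(1) by blast
qed

lemma bounded_if_continuous_compact:
  fixes f :: "'m::topological_space \<Rightarrow> 'f::real_normed_vector"
  assumes "compact (UNIV :: 'm set)" "continuous_on UNIV f"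
  obtains K where "\<And>p. norm (f p) \<le> K"
proof -
  have "bounded (range f)" using assms by (intro compact_imp_bounded compact_continuous_image)
  then show thesis using that unfolding bounded_iff by blast
qed

text \<open>
  The derivative of \<open>f \<circ> T \<omega>\<close> is the product of the gradient of \<open>f\<close> along \<open>T \<omega>\<close>, which is a function of class
  one lower composed with \<open>T \<omega>\<close>, and of a derivative of \<open>\<iota> \<circ> T \<omega>\<close>. Hence the induction over all \<open>f\<close>.
\<close>

lemma equibounded_ck_compose:
  fixes A :: "('x::{t2_space, second_countable_topology}, 'd::euclidean_space) chart set"
    and A' :: "('m::{t2_space, second_countable_topology}, 'e::euclidean_space) chart set"
    and f :: "'m \<Rightarrow> real" and \<iota> :: "'m \<Rightarrow> 'f::euclidean_space"
  assumes "ck_structure k V A" "ck_structure k V' A'" "compact (UNIV :: 'm set)" "ck_embedding k V' A' \<iota>"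
    and "\<And>\<omega>. \<omega> \<in> \<Omega> \<Longrightarrow> ck_map k V A A' (T \<omega>)" "c \<in> A"
    and "equibounded_ck V k (chart_image c) \<Omega> (\<lambda>\<omega>. local_rep c (\<iota> \<circ> T \<omega>))"
    and "j \<le> k" "ck_function j V' A' f"
  shows "equibounded_ck V j (chart_image c) \<Omega> (\<lambda>\<omega>. local_rep c (f \<circ> T \<omega>))"
  using assms(8,9)
proof (induction j arbitrary: f)
  note X = ck_structureD[OF assms(1)] and M = ck_structureD[OF assms(2)]
  note op = chart_image_openin[OF X(2)[OF assms(6)]]
  have bdd: "equibounded_continuous (chart_image c) \<Omega> (\<lambda>\<omega>. local_rep c (f \<circ> T \<omega>))"
    if "ck_function i V' A' f" for i and f :: "'m \<Rightarrow> real"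
  proof -
    have f: "continuous_on UNIV f" by (rule continuous_on_if_ck_function[OF M(2,3) that])
    obtain K where K: "\<And>p. norm (f p) \<le> K" using bounded_if_continuous_compact[OF assms(3) f] by blast
    show ?thesis
    proof (rule equibounded_continuousI)
      fix \<omega> assume "\<omega> \<in> \<Omega>"
      then have "continuous_on UNIV (T \<omega>)" using assms(5) by (simp add: ck_map_def)
      then have "continuous_on UNIV (f \<circ> T \<omega>)"
        using f by (intro continuous_on_compose) (auto intro: continuous_on_subset)
      then have "continuous_on (fst c) (f \<circ> T \<omega>)" by (rule continuous_on_subset) simp
      then show "continuous_on (chart_image c) (local_rep c (f \<circ> T \<omega>))"
        by (rule iffD2[OF continuous_on_local_rep_iff[OF X(2)[OF assms(6)]]])
    next
      show "norm (local_rep c (f \<circ> T \<omega>) y) \<le> K" for \<omega> y using K by (simp add: local_rep_def)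
    qed
  qed
  {
    case 0
    show ?case unfolding equibounded_ck.simps by (rule bdd[OF 0(2)])
  next
    case (Suc j)
    obtain a where a: "ck_function j V' A' a"
      "\<And>d p v. d \<in> A' \<Longrightarrow> p \<in> fst d \<Longrightarrow> v \<in> V' \<Longrightarrow>
         dir_deriv v (local_rep d f) (snd d p) = a p \<bullet> dir_deriv v (local_rep d \<iota>) (snd d p)"
      using gradient_of_ck_function[OF assms(2) Suc.prems(1) assms(4) Suc.prems(2)] by metis
    have k: "1 \<le> k" "j \<le> k" using Suc.prems(1) by simp_all
    have rep: "ck_on V' 1 (chart_image d) (local_rep d f)" "ck_on V' 1 (chart_image d) (local_rep d \<iota>)" if "d \<in> A'" for d
    proof -
      show "ck_on V' 1 (chart_image d) (local_rep d f)"
        using ck_function_le[OF Suc.prems(2), of 1] that by (simp add: ck_function_def del: ck_on.simps One_nat_def)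
      show "ck_on V' 1 (chart_image d) (local_rep d \<iota>)"
        using assms(4) ck_function_le[OF _ k(1)] that unfolding ck_embedding_def ck_function_def by blast
    qed
    show ?case
    proof (rule equibounded_ck_SucI[OF X(1) op bdd[OF Suc.prems(2)]])
      fix v \<omega> y assume *: "v \<in> V" "\<omega> \<in> \<Omega>" "y \<in> chart_image c"
      obtain p where p: "p \<in> fst c" "y = snd c p" using *(3) by (auto simp: chart_image_def)
      obtain d where d: "d \<in> A'" "T \<omega> p \<in> fst d" using M(3) by blast
      interpret ck_map_in_charts k V V' c d "T \<omega>"
        by (rule ck_map_in_charts_if_ck_map[OF assms(1,2) assms(5)[OF *(2)] assms(6) d(1)])
      note Df = dir_deriv_local_rep_compose[OF k(1) rep(1)[OF d(1)] p(1) d(2) *(1)]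
        and D\<iota> = dir_deriv_local_rep_compose[OF k(1) rep(2)[OF d(1)] p(1) d(2) *(1)]
      have "local_rep c (a \<circ> T \<omega>) y = a (T \<omega> p)" using p charts(1) by simp
      then show "((\<lambda>t. local_rep c (f \<circ> T \<omega>) (y + t *\<^sub>R v)) has_vector_derivative
          local_rep c (a \<circ> T \<omega>) y \<bullet> dir_deriv v (local_rep c (\<iota> \<circ> T \<omega>)) y) (at 0)"
        using Df(2) a(2)[OF d Df(1)] D\<iota>(3) p(2) by simp
    next
      fix v assume v: "v \<in> V"
      have "equibounded_ck V (Suc j) (chart_image c) \<Omega> (\<lambda>\<omega>. local_rep c (\<iota> \<circ> T \<omega>))"
        by (rule equibounded_ck_le[OF assms(7) Suc.prems(1)])
      then have D\<iota>: "equibounded_ck V j (chart_image c) \<Omega> (\<lambda>\<omega>. dir_deriv v (local_rep c (\<iota> \<circ> T \<omega>)))"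
        using v by (rule equibounded_ck_SucD(1))
      have comp: "ck_function j V' A' (\<lambda>p. a p \<bullet> i)" for i
        unfolding ck_function_def
      proof
        fix d assume d: "d \<in> A'"
        then have "ck_on V' j (chart_image d) (local_rep d a)" using a(1) by (simp add: ck_function_def)
        then have "ck_on V' j (chart_image d) (\<lambda>y. local_rep d a y \<bullet> i)"
          by (rule bounded_bilinear.ck_on_prod[OF bounded_bilinear_inner M(1) chart_image_openin[OF M(2)[OF d]] _ ck_on_const])
        then show "ck_on V' j (chart_image d) (local_rep d (\<lambda>p. a p \<bullet> i))"
          by (simp add: local_rep_def o_def)
      qed
      have "equibounded_ck V j (chart_image c) \<Omega> (\<lambda>\<omega> y. \<Sum>i\<in>Basis. local_rep c ((\<lambda>p. a p \<bullet> i) \<circ> T \<omega>) y *\<^sub>R i)"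
        by (intro equibounded_ck_sum[OF X(1) op] bounded_bilinear.equibounded_ck_prod[OF bounded_bilinear_scaleR X(1) op]
            Suc.IH[OF k(2) comp] equibounded_ck_const_family[OF ck_on_const])
      then have "equibounded_ck V j (chart_image c) \<Omega> (\<lambda>\<omega>. local_rep c (a \<circ> T \<omega>))"
        by (simp add: local_rep_def o_def euclidean_representation)
      then show "equibounded_ck V j (chart_image c) \<Omega>
          (\<lambda>\<omega> y. local_rep c (a \<circ> T \<omega>) y \<bullet> dir_deriv v (local_rep c (\<iota> \<circ> T \<omega>)) y)"
        using D\<iota> by (rule bounded_bilinear.equibounded_ck_prod[OF bounded_bilinear_inner X(1) op])
    qed
  }
qed

section \<open>Differentiation under the integral sign\<close>

lemma (in finite_measure) integrable_if_equibounded: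
  fixes F :: "'a \<Rightarrow> 'e::real_normed_vector \<Rightarrow> 'f::{banach, second_countable_topology}"
  assumes "equibounded_continuous U (space M) F" "(\<lambda>\<omega>. F \<omega> y) \<in> borel_measurable M" "y \<in> U"
  shows "integrable M (\<lambda>\<omega>. F \<omega> y)"
proof -
  obtain N K where "open N" "y \<in> N" "\<forall>\<omega>\<in>space M. \<forall>z\<in>N \<inter> U. norm (F \<omega> z) \<le> K"
    using equibounded_continuousE[OF assms(1,3)] .
  then have "AE \<omega> in M. norm (F \<omega> y) \<le> K" using assms(3) by (intro AE_I2) blast
  then show ?thesis using assms(2) by (rule integrable_const_bound)
qed

lemma (in finite_measure) continuous_on_integral_if_equibounded:
  fixes F :: "'a \<Rightarrow> 'e::real_normed_vector \<Rightarrow> 'f::{banach, second_countable_topology}"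
  assumes "equibounded_continuous U (space M) F" "\<And>y. y \<in> U \<Longrightarrow> (\<lambda>\<omega>. F \<omega> y) \<in> borel_measurable M"
  shows "continuous_on U (\<lambda>y. \<integral>\<omega>. F \<omega> y \<partial>M)"
  unfolding continuous_on_eq_continuous_within
proof
  fix x assume x: "x \<in> U"
  obtain N K where N: "open N" "x \<in> N" "\<forall>\<omega>\<in>space M. \<forall>z\<in>N \<inter> U. norm (F \<omega> z) \<le> K"
    using equibounded_continuousE[OF assms(1) x] .
  have "(\<lambda>n. \<integral>\<omega>. F \<omega> (X n) \<partial>M) \<longlonglongrightarrow> (\<integral>\<omega>. F \<omega> x \<partial>M)"
    if X: "\<And>n. X n \<in> N \<inter> U" "X \<longlonglongrightarrow> x" for X
  proof (rule integral_dominated_convergence[where w = "\<lambda>_. K"])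
    show "AE \<omega> in M. (\<lambda>n. F \<omega> (X n)) \<longlonglongrightarrow> F \<omega> x"
    proof (rule AE_I2)
      fix \<omega> assume "\<omega> \<in> space M"
      then have "continuous_on U (F \<omega>)" using assms(1) by (simp add: equibounded_continuous_def)
      then show "(\<lambda>n. F \<omega> (X n)) \<longlonglongrightarrow> F \<omega> x"
        using X x continuous_on_sequentially[of U "F \<omega>"] by (simp add: o_def)
    qed
    show "AE \<omega> in M. norm (F \<omega> (X n)) \<le> K" for n
      using N(3) X(1) by (intro AE_I2) blast
  qed (use assms(2) x X(1) in auto)
  then have "continuous (at x within N \<inter> U) (\<lambda>y. \<integral>\<omega>. F \<omega> y \<partial>M)"
    by (simp add: continuous_within_sequentially o_def)
  moreover have "at x within N \<inter> U = at x within U"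
    using N(1,2) by (intro at_within_nhd[of x N]) auto
  ultimately show "continuous (at x within U) (\<lambda>y. \<integral>\<omega>. F \<omega> y \<partial>M)"
    by (simp add: continuous_within)
qed

lemma LIMSEQ_quotient_if_has_vector_derivative:
  assumes "(f has_vector_derivative D) (at 0)" "X \<longlonglongrightarrow> 0" "\<And>n. X n \<noteq> (0::real)"
  shows "(\<lambda>n. (f (X n) - f 0) /\<^sub>R X n) \<longlonglongrightarrow> D"
proof -
  have "((\<lambda>h. (f (0 + h) - f 0) /\<^sub>R h) \<longlongrightarrow> D) (at 0)"
    using assms(1) unfolding has_vector_derivative_iff_quotient .
  then show ?thesis
    using assms(2,3) by (auto simp: tendsto_at_iff_sequentially o_def)
qed

text \<open>
  Difference quotients along a sequence present the derivative as a pointwise limit of measurable functions.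
\<close>

lemma borel_measurable_dir_deriv:
  fixes F :: "'a \<Rightarrow> 'e::real_normed_vector \<Rightarrow> 'f::{banach, second_countable_topology}"
  assumes "subspace V" "openin (top_of_set V) U" "x \<in> U" "v \<in> V"
    and "\<And>y. y \<in> U \<Longrightarrow> (\<lambda>\<omega>. F \<omega> y) \<in> borel_measurable M"
    and "\<And>\<omega>. \<omega> \<in> space M \<Longrightarrow> (\<lambda>t. F \<omega> (x + t *\<^sub>R v)) differentiable (at 0)"
  shows "(\<lambda>\<omega>. dir_deriv v (F \<omega>) x) \<in> borel_measurable M"
proof -
  obtain \<delta> where \<delta>: "\<delta> > 0" "\<And>t. \<bar>t\<bar> < \<delta> \<Longrightarrow> x + t *\<^sub>R v \<in> U"
    using eventually_line_in[OF assms(1-4)] by (auto simp: eventually_nhds_metric)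
  define X where "X n = \<delta> / 2 * inverse (real (Suc n))" for n
  have X: "X n > 0" "\<bar>X n\<bar> < \<delta>" for n
  proof -
    have "inverse (real (Suc n)) > 0" "inverse (real (Suc n)) \<le> 1" by (simp_all add: field_simps)
    then show "X n > 0" "\<bar>X n\<bar> < \<delta>"
      using \<delta>(1) mult_left_mono[of "inverse (real (Suc n))" 1 "\<delta> / 2"] unfolding X_def by simp_all
  qed
  have X0: "X \<longlonglongrightarrow> 0"
    unfolding X_def using tendsto_mult_right_zero[OF LIMSEQ_inverse_real_of_nat] by simp
  show ?thesis
  proof (rule borel_measurable_LIMSEQ_metric)
    show "(\<lambda>\<omega>. (F \<omega> (x + X n *\<^sub>R v) - F \<omega> (x + 0 *\<^sub>R v)) /\<^sub>R X n) \<in> borel_measurable M" for n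
      using assms(5)[OF \<delta>(2)[OF X(2)]] assms(5)[OF assms(3)]
      by (intro borel_measurable_scaleR borel_measurable_diff borel_measurable_const) simp_all
    show "(\<lambda>n. (F \<omega> (x + X n *\<^sub>R v) - F \<omega> (x + 0 *\<^sub>R v)) /\<^sub>R X n) \<longlonglongrightarrow> dir_deriv v (F \<omega>) x"
      if "\<omega> \<in> space M" for \<omega>
      using X(1) by (intro LIMSEQ_quotient_if_has_vector_derivative[OF _ X0] has_vector_derivative_dir_deriv
            assms(6)[OF that]) (metis less_irrefl)
  qed
qed

text \<open>
  By the mean value inequality, a bound for the derivatives near \<open>x\<close> dominates the difference quotients at \<open>x\<close>.
\<close>

lemma (in finite_measure) has_vector_derivative_integral:
  fixes F :: "'a \<Rightarrow> 'e::real_normed_vector \<Rightarrow> 'f::{banach, second_countable_topology}"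
  assumes "subspace V" "openin (top_of_set V) U" "x \<in> U" "v \<in> V"
    and "equibounded_continuous U (space M) F"
    and "equibounded_continuous U (space M) (\<lambda>\<omega>. dir_deriv v (F \<omega>))"
    and "\<And>y. y \<in> U \<Longrightarrow> (\<lambda>\<omega>. F \<omega> y) \<in> borel_measurable M"
    and "\<And>\<omega> y. \<omega> \<in> space M \<Longrightarrow> y \<in> U \<Longrightarrow> (\<lambda>t. F \<omega> (y + t *\<^sub>R v)) differentiable (at 0)"
  shows "((\<lambda>t. \<integral>\<omega>. F \<omega> (x + t *\<^sub>R v) \<partial>M) has_vector_derivative (\<integral>\<omega>. dir_deriv v (F \<omega>) x \<partial>M)) (at 0)"
proof -
  obtain N K where N: "open N" "x \<in> N" "\<forall>\<omega>\<in>space M. \<forall>y\<in>N \<inter> U. norm (dir_deriv v (F \<omega>) y) \<le> K"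
    using equibounded_continuousE[OF assms(6,3)] .
  have "openin (top_of_set V) (U \<inter> N)" using assms(2) N(1) by (rule openin_Int_open)
  from eventually_line_in[OF assms(1) this _ assms(4), of x]
  obtain \<delta> where \<delta>: "\<delta> > 0" "\<And>t. \<bar>t\<bar> < \<delta> \<Longrightarrow> x + t *\<^sub>R v \<in> U \<inter> N"
    using assms(3) N(2) by (auto simp: eventually_nhds_metric)
  have line: "x + t *\<^sub>R v \<in> U" if "\<bar>t\<bar> < \<delta>" for t using \<delta>(2)[OF that] by simp
  have int: "integrable M (\<lambda>\<omega>. F \<omega> y)" if "y \<in> U" for y
    using assms(5) assms(7)[OF that] that by (rule integrable_if_equibounded)
  have lip: "norm (F \<omega> (x + s *\<^sub>R v) - F \<omega> x) \<le> K * \<bar>s\<bar>" if "\<omega> \<in> space M" "\<bar>s\<bar> < \<delta>" for \<omega> s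
  proof -
    have seg: "x + t *\<^sub>R v \<in> U \<inter> N" if "t \<in> closed_segment 0 s" for t
      using that \<open>\<bar>s\<bar> < \<delta>\<close> by (intro \<delta>(2)) (auto simp: closed_segment_eq_real_ivl split: if_splits)
    have "norm (F \<omega> (x + s *\<^sub>R v) - F \<omega> x - s *\<^sub>R 0) \<le> K * \<bar>s\<bar>"
    proof (rule dir_deriv_mean_value)
      fix t assume "t \<in> closed_segment 0 s"
      note t = seg[OF this]
      show "(\<lambda>r. F \<omega> (x + t *\<^sub>R v + r *\<^sub>R v)) differentiable at 0" using assms(8) that(1) t by blast
      show "norm (dir_deriv v (F \<omega>) (x + t *\<^sub>R v) - 0) \<le> K" using N(3) that(1) t by auto
    qed
    then show ?thesis by simp
  qed
  have "(\<lambda>n. ((\<integral>\<omega>. F \<omega> (x + X n *\<^sub>R v) \<partial>M) - (\<integral>\<omega>. F \<omega> x \<partial>M)) /\<^sub>R X n) \<longlonglongrightarrow> (\<integral>\<omega>. dir_deriv v (F \<omega>) x \<partial>M)"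
    if X: "\<And>n. \<bar>X n\<bar> < \<delta>" "\<And>n. X n \<noteq> 0" "X \<longlonglongrightarrow> 0" for X
  proof -
    have "(\<lambda>n. \<integral>\<omega>. (F \<omega> (x + X n *\<^sub>R v) - F \<omega> x) /\<^sub>R X n \<partial>M) \<longlonglongrightarrow> (\<integral>\<omega>. dir_deriv v (F \<omega>) x \<partial>M)"
    proof (rule integral_dominated_convergence[where w = "\<lambda>_. K"])
      show "(\<lambda>\<omega>. dir_deriv v (F \<omega>) x) \<in> borel_measurable M"
        using assms(7) assms(8)[OF _ assms(3)] by (rule borel_measurable_dir_deriv[OF assms(1-4)])
      show "(\<lambda>\<omega>. (F \<omega> (x + X n *\<^sub>R v) - F \<omega> x) /\<^sub>R X n) \<in> borel_measurable M" for n
        using assms(7)[OF line[OF X(1)]] assms(7)[OF assms(3)]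
        by (intro borel_measurable_scaleR borel_measurable_diff borel_measurable_const)
      show "AE \<omega> in M. (\<lambda>n. (F \<omega> (x + X n *\<^sub>R v) - F \<omega> x) /\<^sub>R X n) \<longlonglongrightarrow> dir_deriv v (F \<omega>) x"
      proof (rule AE_I2)
        fix \<omega> assume "\<omega> \<in> space M"
        then have "((\<lambda>t. F \<omega> (x + t *\<^sub>R v)) has_vector_derivative dir_deriv v (F \<omega>) x) (at 0)"
          using assms(3,8) by (intro has_vector_derivative_dir_deriv)
        from LIMSEQ_quotient_if_has_vector_derivative[OF this X(3,2)]
        show "(\<lambda>n. (F \<omega> (x + X n *\<^sub>R v) - F \<omega> x) /\<^sub>R X n) \<longlonglongrightarrow> dir_deriv v (F \<omega>) x" by simp
      qed
      show "AE \<omega> in M. norm ((F \<omega> (x + X n *\<^sub>R v) - F \<omega> x) /\<^sub>R X n) \<le> K" for n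
      proof (rule AE_I2)
        fix \<omega> assume "\<omega> \<in> space M"
        then have "norm ((F \<omega> (x + X n *\<^sub>R v) - F \<omega> x) /\<^sub>R X n) \<le> inverse \<bar>X n\<bar> * (K * \<bar>X n\<bar>)"
          using lip X(1) unfolding norm_scaleR abs_inverse by (intro mult_left_mono) auto
        also have "\<dots> = K" using X(2)[of n] by simp
        finally show "norm ((F \<omega> (x + X n *\<^sub>R v) - F \<omega> x) /\<^sub>R X n) \<le> K" .
      qed
    qed simp
    moreover have "(\<integral>\<omega>. (F \<omega> (x + X n *\<^sub>R v) - F \<omega> x) /\<^sub>R X n \<partial>M) =
        ((\<integral>\<omega>. F \<omega> (x + X n *\<^sub>R v) \<partial>M) - (\<integral>\<omega>. F \<omega> x \<partial>M)) /\<^sub>R X n" for n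
      using int[OF line[OF X(1)]] int[OF assms(3)] by simp
    ultimately show ?thesis by (simp only:)
  qed
  then have "((\<lambda>h. ((\<integral>\<omega>. F \<omega> (x + h *\<^sub>R v) \<partial>M) - (\<integral>\<omega>. F \<omega> x \<partial>M)) /\<^sub>R h) \<longlongrightarrow>
      (\<integral>\<omega>. dir_deriv v (F \<omega>) x \<partial>M)) (at 0 within ball 0 \<delta>)"
    unfolding tendsto_at_iff_sequentially by (simp add: o_def dist_real_def)
  moreover have "at (0::real) within ball 0 \<delta> = at 0"
    using \<delta>(1) by (intro at_within_open) auto
  ultimately show ?thesis
    by (simp add: has_vector_derivative_iff_quotient)
qed

lemma (in finite_measure) ck_on_integral:
  fixes F :: "'a \<Rightarrow> 'e::real_normed_vector \<Rightarrow> 'f::{banach, second_countable_topology}"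
  assumes "subspace V" "openin (top_of_set V) U"
    and "equibounded_ck V k U (space M) F"
    and "\<And>y. y \<in> U \<Longrightarrow> (\<lambda>\<omega>. F \<omega> y) \<in> borel_measurable M"
  shows "ck_on V k U (\<lambda>y. \<integral>\<omega>. F \<omega> y \<partial>M)"
  using assms(3,4)
proof (induction k arbitrary: F)
  case 0
  then show ?case using continuous_on_integral_if_equibounded[of U F] by simp
next
  case (Suc k)
  note bdd = equibounded_ck_imp_continuous[OF Suc.prems(1)]
  show ?case
  proof (rule ck_on_SucI[OF assms(1,2)])
    show "continuous_on U (\<lambda>y. \<integral>\<omega>. F \<omega> y \<partial>M)"
      using bdd Suc.prems(2) by (rule continuous_on_integral_if_equibounded)
  next
    fix v x assume *: "v \<in> V" "x \<in> U"
    note D = equibounded_ck_SucD[OF Suc.prems(1) *(1)]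
    show "((\<lambda>t. \<integral>\<omega>. F \<omega> (x + t *\<^sub>R v) \<partial>M) has_vector_derivative (\<integral>\<omega>. dir_deriv v (F \<omega>) x \<partial>M)) (at 0)"
      using bdd equibounded_ck_imp_continuous[OF D(1)] Suc.prems(2)
        differentiable_if_has_vector_derivative[OF D(2)]
      by (rule has_vector_derivative_integral[OF assms(1,2) *(2,1)])
  next
    fix v assume v: "v \<in> V"
    note D = equibounded_ck_SucD[OF Suc.prems(1) v]
    show "ck_on V k U (\<lambda>x. \<integral>\<omega>. dir_deriv v (F \<omega>) x \<partial>M)"
    proof (rule Suc.IH[OF D(1)])
      show "(\<lambda>\<omega>. dir_deriv v (F \<omega>) y) \<in> borel_measurable M" if y: "y \<in> U" for y
        using Suc.prems(2) differentiable_if_has_vector_derivative[OF D(2)[OF _ y]]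
        by (rule borel_measurable_dir_deriv[OF assms(1,2) y v])
    qed
  qed
qed

section \<open>Regularity of the averages\<close>

theorem proposition7p2:
  fixes k :: nat
    and V\<^sub>M :: "'e::euclidean_space set"
    and A\<^sub>M :: "('m::{t2_space, second_countable_topology}, 'e) chart set"
    and g\<^sub>M :: "('m, 'e) chart \<Rightarrow> 'm \<Rightarrow> 'e \<Rightarrow> 'e \<Rightarrow> real"
    and V\<^sub>X :: "'d::euclidean_space set"
    and A\<^sub>X :: "('x::{t2_space, second_countable_topology}, 'd) chart set"
    and g\<^sub>X :: "('x, 'd) chart \<Rightarrow> 'x \<Rightarrow> 'd \<Rightarrow> 'd \<Rightarrow> real"
    and B :: "('x, 'd) chart set"
    and \<iota> :: "'m \<Rightarrow> 'f::euclidean_space"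
    and \<mu> :: "'x \<Rightarrow> 'm measure"
    and h :: "'m \<Rightarrow> real"
  assumes "k \<ge> 1"
    and "compact_riemannian_manifold k V\<^sub>M A\<^sub>M g\<^sub>M"
    and "compact_riemannian_manifold k V\<^sub>X A\<^sub>X g\<^sub>X"
    and "finite_subatlas A\<^sub>X B"
    and "ck_embedding k V\<^sub>M A\<^sub>M \<iota>"
    and "\<And>x. prob_space (\<mu> x)"
    and "\<And>x. sets (\<mu> x) = sets borel"
    and "boundedly_ck_representable TYPE('w) k V\<^sub>X A\<^sub>X B A\<^sub>M \<iota> \<mu>"
    and "ck_function k V\<^sub>M A\<^sub>M h"
  shows "ck_function k V\<^sub>X A\<^sub>X (\<lambda>x. \<integral>p. h p \<partial>\<mu> x)"
proof -
  have M: "compact (UNIV :: 'm set)" "ck_structure k V\<^sub>M A\<^sub>M"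
    using assms(2) by (simp_all add: compact_riemannian_manifold_def)
  have X: "ck_structure k V\<^sub>X A\<^sub>X" using assms(3) by (simp add: compact_riemannian_manifold_def)
  have B: "B \<subseteq> A\<^sub>X" "(\<Union>c\<in>B. fst c) = UNIV" using assms(4) by (simp_all add: finite_subatlas_def)
  note X' = ck_structureD[OF X] and M' = ck_structureD[OF M(2)]
  obtain P :: "'w measure" and T C where P: "rochlin_lebesgue_space P"
    and T: "T \<in> borel \<Otimes>\<^sub>M P \<rightarrow>\<^sub>M borel" and C: "C > 0"
    and distr: "\<forall>x. distr P borel (\<lambda>\<omega>. T (x, \<omega>)) = \<mu> x"
    and bound: "\<forall>\<omega>\<in>space P. ck_map k V\<^sub>X A\<^sub>X A\<^sub>M (\<lambda>x. T (x, \<omega>)) \<and>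
           ck_seminorm k V\<^sub>X B (\<lambda>x. \<iota> (T (x, \<omega>))) \<le> ennreal C"
    using assms(8) unfolding boundedly_ck_representable_def by blast
  interpret P: prob_space P using P by (simp add: rochlin_lebesgue_space_def)
  define S where "S \<omega> x = T (x, \<omega>)" for \<omega> x
  have S_ck: "ck_map k V\<^sub>X A\<^sub>X A\<^sub>M (S \<omega>)" if "\<omega> \<in> space P" for \<omega>
    using bound that by (simp add: S_def[abs_def])
  have S_seminorm: "ck_seminorm k V\<^sub>X B (\<iota> \<circ> S \<omega>) \<le> ennreal C" if "\<omega> \<in> space P" for \<omega>
    using bound that by (simp add: S_def[abs_def] o_def)
  have S_meas: "(\<lambda>\<omega>. S \<omega> x) \<in> P \<rightarrow>\<^sub>M borel" for x
    unfolding S_def using measurable_compose[OF measurable_Pair1' T] by simp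

  have h_cont: "continuous_on UNIV h" by (rule continuous_on_if_ck_function[OF M'(2,3) assms(9)])
  then have h_meas: "h \<in> borel_measurable borel" by (rule borel_measurable_continuous_onI)
  have E_eq: "(\<integral>p. h p \<partial>\<mu> x) = (\<integral>\<omega>. h (S \<omega> x) \<partial>P)" for x
  proof -
    have "distr P borel (\<lambda>\<omega>. S \<omega> x) = \<mu> x" using distr by (simp add: S_def)
    then show ?thesis using integral_distr[OF S_meas h_meas, of x] by simp
  qed

  have \<iota>: "ck_function k V\<^sub>M A\<^sub>M \<iota>" using assms(5) by (simp add: ck_embedding_def)
  obtain K where K: "\<And>p. norm (\<iota> p) \<le> K"
    using bounded_if_continuous_compact[OF M(1) continuous_on_if_ck_function[OF M'(2,3) \<iota>]] by blast
  have \<iota>S: "equibounded_ck V\<^sub>X k (chart_image c) (space P) (\<lambda>\<omega>. local_rep c (\<iota> \<circ> S \<omega>))" if c: "c \<in> B" for c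
  proof (rule equibounded_ck_if_unit_bounds[OF X'(1)])
    have cA: "c \<in> A\<^sub>X" using c B(1) by blast
    show "openin (top_of_set V\<^sub>X) (chart_image c)" by (rule chart_image_openin[OF X'(2)[OF cA]])
    show "ck_on V\<^sub>X k (chart_image c) (local_rep c (\<iota> \<circ> S \<omega>))" if "\<omega> \<in> space P" for \<omega>
    proof (rule ck_on_local_rep_composeI[OF X'(2)[OF cA]])
      fix p
      obtain d where d: "d \<in> A\<^sub>M" "S \<omega> p \<in> fst d" using M'(3) by blast
      then show "\<exists>d. S \<omega> p \<in> fst d \<and> ck_map_in_charts k V\<^sub>X V\<^sub>M c d (S \<omega>) \<and> ck_on V\<^sub>M k (chart_image d) (local_rep d \<iota>)"
        using ck_map_in_charts_if_ck_map[OF X M(2) S_ck[OF that] cA d(1)] \<iota> unfolding ck_function_def by blast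
    qed
    fix \<omega> y vs
    assume *: "\<omega> \<in> space P" "y \<in> chart_image c" "set vs \<subseteq> V\<^sub>X \<inter> cball 0 1" "length vs \<le> k"
    show "norm (iter_dir_deriv vs (local_rep c (\<iota> \<circ> S \<omega>)) y) \<le> max C K"
    proof (cases "vs = []")
      case True
      have "norm (local_rep c (\<iota> \<circ> S \<omega>) y) \<le> K" using K by (simp add: local_rep_def)
      then show ?thesis using True by simp
    next
      case False
      then have "length vs \<in> {1..k}" using *(4) by (cases vs) auto
      from norm_iter_dir_deriv_le_ck_seminorm[OF S_seminorm[OF *(1)] less_imp_le[OF C] c *(2,3) this]
      show ?thesis by simp
    qed
  qed

  have in_B: "ck_on V\<^sub>X k (chart_image c) (local_rep c (\<lambda>x. \<integral>p. h p \<partial>\<mu> x))" if c: "c \<in> B" for c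
  proof -
    have cA: "c \<in> A\<^sub>X" using c B(1) by blast
    have "equibounded_ck V\<^sub>X k (chart_image c) (space P) (\<lambda>\<omega>. local_rep c (h \<circ> S \<omega>))"
      by (rule equibounded_ck_compose[OF X M(2,1) assms(5) S_ck cA \<iota>S[OF c] order_refl assms(9)])
    moreover have "(\<lambda>\<omega>. local_rep c (h \<circ> S \<omega>) y) \<in> borel_measurable P" for y
      using measurable_compose[OF S_meas h_meas] by (simp add: local_rep_def)
    ultimately have "ck_on V\<^sub>X k (chart_image c) (\<lambda>y. \<integral>\<omega>. local_rep c (h \<circ> S \<omega>) y \<partial>P)"
      by (rule P.ck_on_integral[OF X'(1) chart_image_openin[OF X'(2)[OF cA]]])
    then show ?thesis by (simp add: local_rep_def o_def E_eq)
  qed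
  have "ck_on V\<^sub>X k (chart_image c) (local_rep c ((\<lambda>x. \<integral>p. h p \<partial>\<mu> x) \<circ> (\<lambda>x. x)))" if c: "c \<in> A\<^sub>X" for c
  proof (rule ck_on_local_rep_composeI[OF X'(2)[OF c]])
    fix x
    obtain d where d: "d \<in> B" "x \<in> fst d" using B(2) by blast
    then have "d \<in> A\<^sub>X" using B(1) by blast
    then show "\<exists>d. x \<in> fst d \<and> ck_map_in_charts k V\<^sub>X V\<^sub>X c d (\<lambda>x. x) \<and>
        ck_on V\<^sub>X k (chart_image d) (local_rep d (\<lambda>x. \<integral>p. h p \<partial>\<mu> x))"
      using d ck_map_in_charts_id[OF X c] in_B by blast
  qed
  then show ?thesis by (simp add: ck_function_def o_def)
qed

end
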